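(* Let $d\ge1$ and $s>2$. There exists $1<p_1<2$ depending only on $(s,d)$ such that for every $p\in(1,p_1]$ the following hold. (i) There is $f\in C_c^\infty(\mathbb R^d,\mathbb R)$ with \[ \int_{\mathbb R^d}(\Lambda^s f)\,|f|^{p-2}f\,dx\le -C_{p,d,s}<0, \] where $C_{p,d,s}>0$ depends only on $(p,d,s)$. (ii) There exist constants $D_1,D_2,\alpha_1,\alpha_2>0$ depending on $(p,d,s)$, a sequence $N_j\to\infty$, and real-valued Schwartz functions $f_j:\mathbb R^d\to\mathbb R$ with $\mathrm{supp}(\widehat{f_j})\subset\{\xi:\ \alpha_1N_j<|\xi|<\alpha_2N_j\}$ such that \[ -D_2<\frac{\int_{\mathbb R^d}(\Lambda^s f_j)\,|f_j|^{p-2}f_j\,dx}{N_j^s\int_{\mathbb R^d}|f_j|^p\,dx}<-D_1<0 . \]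
   Context: The Fourier transform on $\mathbb R^d$ is $\widehat f(\xi)=\int_{\mathbb R^d}f(x)e^{-i\xi\cdot x}dx$. For $s>0$, $\Lambda^s=(-\Delta)^{s/2}$ is the Fourier multiplier operator $\widehat{\Lambda^s f}(\xi)=|\xi|^s\widehat f(\xi)$. *)

theory Defs
  imports "HOL-Analysis.Analysis"
begin

text \<open>R^d is modelled by an arbitrary Euclidean space 'a (d = DIM('a) \<ge> 1).\<close>

fun iter_partial :: "'a::euclidean_space list \<Rightarrow> ('a \<Rightarrow> real) \<Rightarrow> 'a \<Rightarrow> real" where
  "iter_partial [] f = f"
| "iter_partial (v # vs) f = (\<lambda>x. frechet_derivative (iter_partial vs f) (at x) v)"

definition smooth :: "('a::euclidean_space \<Rightarrow> real) \<Rightarrow> bool" where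
  "smooth f \<longleftrightarrow> (\<forall>vs. set vs \<subseteq> Basis \<longrightarrow> (\<forall>x. iter_partial vs f differentiable (at x)))"

definition smooth_compact_support :: "('a::euclidean_space \<Rightarrow> real) \<Rightarrow> bool" where
  "smooth_compact_support f \<longleftrightarrow> smooth f \<and> compact (closure {x. f x \<noteq> 0})"

definition schwartz :: "('a::euclidean_space \<Rightarrow> real) \<Rightarrow> bool" where
  "schwartz f \<longleftrightarrow> smooth f \<and>
     (\<forall>vs m::nat. set vs \<subseteq> Basis \<longrightarrow> bounded (range (\<lambda>x. norm x ^ m * iter_partial vs f x)))"

definition fourier :: "('a::euclidean_space \<Rightarrow> real) \<Rightarrow> 'a \<Rightarrow> complex" where
  "fourier f \<xi> = (\<integral>x. complex_of_real (f x) * cis (- (\<xi> \<bullet> x)) \<partial>lborel)"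

text \<open>Lambda^s = (-Delta)^{s/2}, Fourier multiplier |xi|^s, via the inverse Fourier transform
  (2 pi)^{-d} \<integral> |xi|^s f^(xi) e^{i xi.x} dxi.  For real f this is real; we take the real part.\<close>
definition frac_lap :: "real \<Rightarrow> ('a::euclidean_space \<Rightarrow> real) \<Rightarrow> 'a \<Rightarrow> real" where
  "frac_lap s f x = Re ((1 / (2 * pi)) ^ DIM('a) *
      (\<integral>\<xi>. complex_of_real (norm \<xi> powr s) * fourier f \<xi> * cis (\<xi> \<bullet> x) \<partial>lborel))"

text \<open>|y|^{p-2} y, interpreted as sgn(y) |y|^{p-1} (value 0 at y = 0).\<close>
definition pow_sgn :: "real \<Rightarrow> real \<Rightarrow> real" where
  "pow_sgn p y = sgn y * \<bar>y\<bar> powr (p - 1)"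

end

theory Submission
  imports Defs "HOL-Probability.Probability"
begin

text \<open>Take a trigonometric polynomial \<open>P\<close> in one variable and modulate a fixed profile \<open>g\<close>:
  \<open>f(x) = P(N x\<^sub>e + \<theta>) g(x)\<close>. As \<open>N\<close> tends to infinity,
  \<open>N\<^sup>-\<^sup>s \<Lambda>\<^sup>s f\<close> is uniformly close to \<open>(\<Lambda>\<^sup>s P)(N x\<^sub>e + \<theta>) g(x)\<close>, and averaging over
  the phase \<open>\<theta>\<close> reduces the claim to the negativity of the mean of \<open>(\<Lambda>\<^sup>s P) \<bar>P\<bar>\<^bsup>p-2\<^esup> P\<close> over a
  period. For \<open>P = cos t + cos (3t) / 3 = (4/3) cos\<^sup>3 t\<close> the sign of \<open>P\<close> is that of \<open>cos t\<close>, whose Fourier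
  coefficients at frequencies 1 and 3 are in the ratio \<open>1 : -1/3\<close>; hence at \<open>p = 1\<close> the mean is a positive
  multiple of \<open>1 - 3\<^bsup>s-2\<^esup>\<close>, which is negative exactly for \<open>s > 2\<close>. The profile \<open>g\<close> is a tensor power of a bump
  function for (i), and of the Fourier transform of that bump for (ii).\<close>

section \<open>Smooth functions of one variable\<close>

text \<open>For p > 1 the function \<open>pow_sgn p (P t)\<close> is no longer a multiple of the
  sign of \<open>cos t\<close>, and its first and third Fourier coefficients are no longer in the
  ratio 1 : -1/3. The mean over a period is therefore estimated through an explicit primitive, which
  yields a threshold for p in terms of s alone. The phase \<theta> replaces an equidistribution
  argument: averaging over a full period asks only that the weight |g|^p be integrable, whatever its
  behaviour where g changes sign. The price is that \<theta> is not explicit and varies with N, so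
  the error in \<open>frac_lap\<close> has to be bounded uniformly in \<theta>. That error is
  controlled only in the sup norm; it is paired with |f|^(p-1), where p - 1 may be tiny, and this is
  why g must decay rapidly. Finally, \<open>frac_lap\<close> is a frequency integral, so recognising
  g in its leading term requires Fourier inversion. Inversion is proved for even compactly supported
  functions of one variable, whose transforms are real, and carried to R^d by tensor
  products.\<close>

text \<open>Smoothness with every derivative, including the zeroth, satisfying \<open>Q\<close>: compact support and
  rapid decay are instances.\<close>

coinductive all_derivs :: "((real \<Rightarrow> real) \<Rightarrow> bool) \<Rightarrow> (real \<Rightarrow> real) \<Rightarrow> bool" for Q where
  all_derivsI: "Q u \<Longrightarrow> (\<And>t. (u has_real_derivative u' t) (at t)) \<Longrightarrow> all_derivs Q u' \<Longrightarrow> all_derivs Q u"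

text \<open>The weight is \<open>1 + \<bar>t\<bar>\<close> because the product of these weights over
  the coordinates dominates \<open>1 + norm x\<close>; decay in R^d then splits into decay of the
  factors.\<close>

definition rapid :: "(real \<Rightarrow> real) \<Rightarrow> bool" where
  "rapid u \<longleftrightarrow> (\<forall>m. \<exists>C. \<forall>t. (1 + \<bar>t\<bar>) ^ m * \<bar>u t\<bar> \<le> C)"

text \<open>The endpoints are included, so that integration by parts over [-1,1] leaves no boundary
  terms.\<close>

definition supp1 :: "(real \<Rightarrow> real) \<Rightarrow> bool" where
  "supp1 u \<longleftrightarrow> (\<forall>t. \<bar>t\<bar> \<ge> 1 \<longrightarrow> u t = 0)"

lemma all_derivsD: "all_derivs Q u \<Longrightarrow> Q u"
  by (auto elim: all_derivs.cases)

lemma all_derivs_step: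
  assumes "all_derivs Q u"
  shows "\<exists>u'. (\<forall>t. (u has_real_derivative u' t) (at t)) \<and> all_derivs Q u'"
  using assms by cases blast

text \<open>Coinduction in the form used throughout: to prove smoothness, exhibit a family that
  contains the function and is closed under differentiation.\<close>

lemma all_derivs_coinduct_set:
  assumes "u \<in> X"
    and "\<And>w. w \<in> X \<Longrightarrow> Q w"
    and "\<And>w. w \<in> X \<Longrightarrow> \<exists>w'\<in>X. \<forall>t. (w has_real_derivative w' t) (at t)"
  shows "all_derivs Q u"
  using assms(1)
proof (coinduction arbitrary: u)
  case all_derivs
  then show ?case using assms(2,3) by blast
qed

lemma all_derivs_continuous: "all_derivs Q u \<Longrightarrow> continuous_on A u"
  by (metis all_derivs_step DERIV_isCont continuous_at_imp_continuous_on)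

lemma all_derivs_measurable: "all_derivs Q u \<Longrightarrow> u \<in> borel_measurable borel"
  by (intro borel_measurable_continuous_onI all_derivs_continuous)

lemma all_derivs_lincomb:
  assumes Q: "\<And>a b u w. Q u \<Longrightarrow> Q w \<Longrightarrow> Q (\<lambda>t. a * u t + b * w t)"
    and "all_derivs Q u" "all_derivs Q w"
  shows "all_derivs Q (\<lambda>t. a * u t + b * w t)"
proof (rule all_derivs_coinduct_set[of _ "{\<lambda>t. a * u t + b * w t | u w. all_derivs Q u \<and> all_derivs Q w}"])
  fix y assume "y \<in> {\<lambda>t. a * u t + b * w t | u w. all_derivs Q u \<and> all_derivs Q w}"
  then obtain u w where y: "y = (\<lambda>t. a * u t + b * w t)" "all_derivs Q u" "all_derivs Q w" by auto
  obtain u' where u': "\<And>t. (u has_real_derivative u' t) (at t)" "all_derivs Q u'" using all_derivs_step[OF y(2)] by blast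
  obtain w' where w': "\<And>t. (w has_real_derivative w' t) (at t)" "all_derivs Q w'" using all_derivs_step[OF y(3)] by blast
  show "\<exists>y'\<in>{\<lambda>t. a * u t + b * w t | u w. all_derivs Q u \<and> all_derivs Q w}. \<forall>t. (y has_real_derivative y' t) (at t)"
    by (rule bexI[of _ "\<lambda>t. a * u' t + b * w' t"])
       (use u' w' in \<open>auto simp: y(1) intro!: DERIV_add DERIV_cmult\<close>)
  show "Q y" using y assms(1) by (auto dest!: all_derivsD)
qed (use assms(2,3) in blast)

lemma rapid_lincomb:
  assumes "rapid u" "rapid w" shows "rapid (\<lambda>t. a * u t + b * w t)"
  unfolding rapid_def
proof
  fix m
  obtain C D where "\<forall>t. (1 + \<bar>t\<bar>) ^ m * \<bar>u t\<bar> \<le> C" "\<forall>t. (1 + \<bar>t\<bar>) ^ m * \<bar>w t\<bar> \<le> D"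
    using assms unfolding rapid_def by meson
  then have "(1 + \<bar>t\<bar>) ^ m * \<bar>a * u t + b * w t\<bar> \<le> \<bar>a\<bar> * C + \<bar>b\<bar> * D" for t
  proof -
    have "(1 + \<bar>t\<bar>) ^ m * \<bar>a * u t + b * w t\<bar> \<le> (1 + \<bar>t\<bar>) ^ m * (\<bar>a\<bar> * \<bar>u t\<bar> + \<bar>b\<bar> * \<bar>w t\<bar>)"
      by (intro mult_left_mono) (auto simp: abs_mult[symmetric])
    also have "\<dots> = \<bar>a\<bar> * ((1 + \<bar>t\<bar>) ^ m * \<bar>u t\<bar>) + \<bar>b\<bar> * ((1 + \<bar>t\<bar>) ^ m * \<bar>w t\<bar>)"
      by (simp add: algebra_simps)
    also have "\<dots> \<le> \<bar>a\<bar> * C + \<bar>b\<bar> * D"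
      by (intro add_mono mult_left_mono) (use \<open>\<forall>t. _ \<le> C\<close> \<open>\<forall>t. _ \<le> D\<close> in auto)
    finally show ?thesis .
  qed
  then show "\<exists>C. \<forall>t. (1 + \<bar>t\<bar>) ^ m * \<bar>a * u t + b * w t\<bar> \<le> C" by blast
qed

text \<open>Differentiating a cosine shifts its phase by pi/2, so sums of this single shape, with a
  free phase d, are closed under differentiation without a separate sine case.\<close>

inductive_set modulated :: "(real \<Rightarrow> real) set" where
  base: "all_derivs rapid w \<Longrightarrow> (\<lambda>t. a * cos (c * t + d) * w t) \<in> modulated"
| add: "u \<in> modulated \<Longrightarrow> w \<in> modulated \<Longrightarrow> (\<lambda>t. u t + w t) \<in> modulated"

lemma all_derivs_modulated:
  assumes "u \<in> modulated" shows "all_derivs rapid u"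
proof (rule all_derivs_coinduct_set[OF assms])
  fix w assume "w \<in> modulated" then show "rapid w"
  proof induction
    case (base w a c d)
    show ?case unfolding rapid_def
    proof
      fix m
      obtain C where C: "\<forall>t. (1 + \<bar>t\<bar>) ^ m * \<bar>w t\<bar> \<le> C"
        using all_derivsD[OF base] unfolding rapid_def by meson
      have "(1 + \<bar>t\<bar>) ^ m * \<bar>a * cos (c * t + d) * w t\<bar> \<le> \<bar>a\<bar> * 1 * C" for t
      proof -
        have "(1 + \<bar>t\<bar>) ^ m * \<bar>a * cos (c * t + d) * w t\<bar> = \<bar>a\<bar> * \<bar>cos (c * t + d)\<bar> * ((1 + \<bar>t\<bar>) ^ m * \<bar>w t\<bar>)"
          by (simp add: abs_mult)
        also have "\<dots> \<le> \<bar>a\<bar> * 1 * C" using C by (intro mult_mono) auto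
        finally show ?thesis .
      qed
      then show "\<exists>C. \<forall>t. (1 + \<bar>t\<bar>) ^ m * \<bar>a * cos (c * t + d) * w t\<bar> \<le> C" by blast
    qed
  next
    case (add u w)
    then show ?case using rapid_lincomb[of u w 1 1] by simp
  qed
next
  fix w assume "w \<in> modulated"
  then show "\<exists>w'\<in>modulated. \<forall>t. (w has_real_derivative w' t) (at t)"
  proof induction
    case (base w a c d)
    obtain w' where w': "\<And>t. (w has_real_derivative w' t) (at t)" "all_derivs rapid w'" using all_derivs_step[OF base] by blast
    have "(\<lambda>t. (a * c) * cos (c * t + (d + pi/2)) * w t + a * cos (c * t + d) * w' t) \<in> modulated"
      by (intro modulated.intros base w')
    moreover have "((\<lambda>t. a * cos (c * t + d) * w t) has_real_derivative
       (a * c) * cos (c * t + (d + pi/2)) * w t + a * cos (c * t + d) * w' t) (at t)" for t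
    proof -
      have "cos (c * t + (d + pi/2)) = - sin (c * t + d)"
        by (simp add: cos_add sin_add algebra_simps)
      then show ?thesis
        by (auto intro!: derivative_eq_intros w' simp: algebra_simps)
    qed
    ultimately show ?case by (intro bexI[of _ "\<lambda>t. (a * c) * cos (c * t + (d + pi/2)) * w t + a * cos (c * t + d) * w' t"]) auto
  next
    case (add u w)
    then obtain u' w' where "u' \<in> modulated" "w' \<in> modulated" "\<forall>t. (u has_real_derivative u' t) (at t)" "\<forall>t. (w has_real_derivative w' t) (at t)" by blast
    then show ?case by (intro bexI[of _ "\<lambda>t. u' t + w' t"]) (auto intro: modulated.intros DERIV_add)
  qed
qed

section \<open>Flat functions and a smooth bump\<close>

definition expinv :: "nat \<Rightarrow> real \<Rightarrow> real" where
  "expinv k t = (if t \<le> 0 then 0 else exp (- (1 / t)) / t ^ k)"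

lemma tendsto_expinv: "(expinv k \<longlongrightarrow> 0) (at 0)"
proof -
  have "((\<lambda>t. (1/t) ^ k / exp (1/t)) \<longlongrightarrow> (0::real)) (at_right 0)"
    by (rule filterlim_compose[OF tendsto_power_div_exp_0]) (simp add: filterlim_inverse_at_top_right flip: inverse_eq_divide)
  then have "(expinv k \<longlongrightarrow> 0) (at_right 0)"
    by (rule Lim_transform_eventually)
       (auto simp: eventually_at_filter expinv_def exp_minus power_divide field_simps)
  moreover have "(expinv k \<longlongrightarrow> 0) (at_left 0)"
    by (rule Lim_transform_eventually[OF tendsto_const])
       (auto simp: eventually_at_filter expinv_def)
  ultimately show ?thesis by (simp add: filterlim_split_at)
qed

text \<open>The power in the denominator makes the family closed under differentiation. At 0 the
  difference quotient of \<open>expinv k\<close> is exactly \<open>expinv (Suc k)\<close>, so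
  differentiability there is the limit in \<open>tendsto_expinv\<close>.\<close>

lemma DERIV_expinv:
  "(expinv k has_real_derivative (- real k * expinv (Suc k) t + expinv (k + 2) t)) (at t)"
proof -
  consider "t < 0" | "t = 0" | "t > 0" by linarith
  then show ?thesis
  proof cases
    case 1
    have "((\<lambda>_. 0) has_real_derivative 0) (at t)" by simp
    then have "(expinv k has_real_derivative 0) (at t)"
      by (rule has_field_derivative_transform_within_open[of _ _ _ "{..<0}"])
         (use 1 in \<open>auto simp: expinv_def\<close>)
    then show ?thesis using 1 by (simp add: expinv_def)
  next
    case 2
    have "((\<lambda>y. (expinv k y - expinv k 0) / (y - 0)) \<longlongrightarrow> 0) (at 0)"
      by (rule Lim_transform_eventually[OF tendsto_expinv[of "Suc k"]])
         (auto simp: eventually_at_filter expinv_def)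
    then show ?thesis using 2 by (simp add: has_field_derivative_iff expinv_def)
  next
    case 3
    have "((\<lambda>t. exp (- (1 / t)) / t ^ k) has_real_derivative (- real k * expinv (Suc k) t + expinv (k + 2) t)) (at t)"
    proof -
      have "((\<lambda>t. exp (- (1 / t))) has_real_derivative exp (- (1 / t)) / t ^ 2) (at t)"
        using 3 by (auto intro!: derivative_eq_intros simp: power2_eq_square)
      from DERIV_divide[OF this DERIV_pow[of k]] 3
      have "((\<lambda>t. exp (- (1 / t)) / t ^ k) has_real_derivative
          (exp (- (1 / t)) / t\<^sup>2 * t ^ k - exp (- (1 / t)) * (real k * t ^ (k - Suc 0))) / (t ^ k * t ^ k)) (at t)"
        by simp
      moreover have "(exp (- (1 / t)) / t\<^sup>2 * t ^ k - exp (- (1 / t)) * (real k * t ^ (k - Suc 0))) / (t ^ k * t ^ k)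
          = - real k * expinv (Suc k) t + expinv (k + 2) t"
        using 3 by (cases k) (auto simp: expinv_def field_simps power2_eq_square)
      ultimately show ?thesis by simp
    qed
    then show ?thesis
      by (rule has_field_derivative_transform_within_open[of _ _ _ "{0<..}"])
         (use 3 in \<open>auto simp: expinv_def\<close>)
  qed
qed

text \<open>The product rule and \<open>DERIV_expinv\<close> turn each generator into four
  generators, and every member vanishes outside (-1,1).\<close>

inductive_set bumps :: "(real \<Rightarrow> real) set" where
  base: "(\<lambda>t. c * expinv j (1 - t) * expinv k (1 + t)) \<in> bumps"
| add: "u \<in> bumps \<Longrightarrow> w \<in> bumps \<Longrightarrow> (\<lambda>t. u t + w t) \<in> bumps"

definition bump :: "real \<Rightarrow> real" where
  "bump t = expinv 0 (1 - t) * expinv 0 (1 + t)"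

lemma all_derivs_bump: "all_derivs supp1 bump"
proof (rule all_derivs_coinduct_set[of _ bumps])
  show "bump \<in> bumps" using bumps.base[of 1 0 0] by (simp add: bump_def[abs_def])
next
  fix w assume "w \<in> bumps" then show "supp1 w"
    by induction (auto simp: supp1_def expinv_def)
next
  fix w assume "w \<in> bumps"
  then show "\<exists>w'\<in>bumps. \<forall>t. (w has_real_derivative w' t) (at t)"
  proof induction
    case (base c j k)
    let ?w = "\<lambda>t. ((c * real j) * expinv (Suc j) (1 - t) * expinv k (1 + t) + (- c) * expinv (j + 2) (1 - t) * expinv k (1 + t))
      + ((- c * real k) * expinv j (1 - t) * expinv (Suc k) (1 + t) + c * expinv j (1 - t) * expinv (k + 2) (1 + t))"
    have "?w \<in> bumps" by (intro bumps.intros)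
    moreover have "((\<lambda>t. c * expinv j (1 - t) * expinv k (1 + t)) has_real_derivative ?w t) (at t)" for t
    proof -
      have d1: "((\<lambda>t. expinv j (1 - t)) has_real_derivative (- real j * expinv (Suc j) (1 - t) + expinv (j + 2) (1 - t)) * - 1) (at t)"
        by (rule DERIV_chain2[OF DERIV_expinv]) (auto intro!: derivative_eq_intros)
      have d2: "((\<lambda>t. expinv k (1 + t)) has_real_derivative (- real k * expinv (Suc k) (1 + t) + expinv (k + 2) (1 + t)) * 1) (at t)"
        by (rule DERIV_chain2[OF DERIV_expinv]) (auto intro!: derivative_eq_intros)
      show ?thesis
        by (rule DERIV_cong[OF DERIV_mult[OF DERIV_cmult[OF d1, of c] d2]]) (simp add: algebra_simps)
    qed
    ultimately show ?case by (intro bexI[of _ ?w]) auto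
  next
    case (add u w)
    then obtain u' w' where "u' \<in> bumps" "w' \<in> bumps" "\<forall>t. (u has_real_derivative u' t) (at t)" "\<forall>t. (w has_real_derivative w' t) (at t)" by blast
    then show ?case by (intro bexI[of _ "\<lambda>t. u' t + w' t"]) (auto intro: bumps.intros DERIV_add)
  qed
qed

lemma bump_even: "bump (- t) = bump t" by (simp add: bump_def)
lemma bump_pos: "\<bar>t\<bar> < 1 \<Longrightarrow> bump t > 0" by (auto simp: bump_def expinv_def)
lemma bump_nonneg: "bump t \<ge> 0" by (auto simp: bump_def expinv_def)

lemma supp1_rapid:
  assumes "supp1 w" "continuous_on UNIV w" shows "rapid w"
  unfolding rapid_def
proof
  fix m
  have "compact ((\<lambda>t. (1 + \<bar>t\<bar>) ^ m * \<bar>w t\<bar>) ` {-1..1})"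
    by (intro compact_continuous_image continuous_intros continuous_on_subset[OF assms(2)]) auto
  then obtain C where C: "\<And>t. t \<in> {-1..1} \<Longrightarrow> (1 + \<bar>t\<bar>) ^ m * \<bar>w t\<bar> \<le> C"
    by (force dest!: compact_imp_bounded simp: bounded_iff)
  have "(1 + \<bar>t\<bar>) ^ m * \<bar>w t\<bar> \<le> max C 0" for t
  proof (cases "\<bar>t\<bar> \<ge> 1")
    case True then show ?thesis using assms(1) by (simp add: supp1_def)
  next
    case False
    then have "t \<in> {-1..1}" by auto
    from C[OF this] show ?thesis by simp
  qed
  then show "\<exists>C. \<forall>t. (1 + \<bar>t\<bar>) ^ m * \<bar>w t\<bar> \<le> C" by blast
qed

lemma all_derivs_supp1_rapid: "all_derivs supp1 w \<Longrightarrow> all_derivs rapid w"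
proof (rule all_derivs_coinduct_set[of _ "Collect (all_derivs supp1)"])
  show "\<exists>w'\<in>Collect (all_derivs supp1). \<forall>t. (w has_real_derivative w' t) (at t)" if "w \<in> Collect (all_derivs supp1)" for w
    using that all_derivs_step by fastforce
qed (auto intro: supp1_rapid dest: all_derivsD all_derivs_continuous)

section \<open>Tensor products\<close>

text \<open>The factor may depend on the basis vector, so that a partial derivative or a modulation
  changes one factor only. The codomain is generic because the same product also serves complex
  Fourier integrands.\<close>

definition tensor :: "('a::euclidean_space \<Rightarrow> real \<Rightarrow> 'b::comm_monoid_mult) \<Rightarrow> 'a \<Rightarrow> 'b" where
  "tensor u x = (\<Prod>b\<in>Basis. u b (x \<bullet> b))"

lemma tensor_has_derivative:
  fixes u :: "'a::euclidean_space \<Rightarrow> real \<Rightarrow> real"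
  assumes "\<And>b t. b \<in> Basis \<Longrightarrow> (u b has_real_derivative u' b t) (at t)"
  shows "(tensor u has_derivative (\<lambda>y. \<Sum>b\<in>Basis. (y \<bullet> b) * tensor (u(b := u' b)) x)) (at x)"
proof -
  have "((\<lambda>x. u b (x \<bullet> b)) has_derivative (\<lambda>y. (y \<bullet> b) * u' b (x \<bullet> b))) (at x)" if "b \<in> Basis" for b
  proof -
    have "(u b has_derivative (\<lambda>y. y * u' b (x \<bullet> b))) (at (x \<bullet> b))"
      using assms[OF that] by (simp add: has_field_derivative_def mult.commute[of _ "u' b (x \<bullet> b)"])
    from has_derivative_compose[OF has_derivative_inner_left[OF has_derivative_ident] this]
    show ?thesis by simp
  qed
  from has_derivative_prod[OF this]
  have "(tensor u has_derivative (\<lambda>y. \<Sum>b\<in>Basis. (y \<bullet> b) * u' b (x \<bullet> b) * (\<Prod>c\<in>Basis - {b}. u c (x \<bullet> c)))) (at x)"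
    by (simp add: tensor_def[abs_def])
  moreover have "(y \<bullet> b) * u' b (x \<bullet> b) * (\<Prod>c\<in>Basis - {b}. u c (x \<bullet> c)) = (y \<bullet> b) * tensor (u(b := u' b)) x"
    if "b \<in> Basis" for b y
  proof -
    have "tensor (u(b := u' b)) x = u' b (x \<bullet> b) * (\<Prod>c\<in>Basis - {b}. (u(b := u' b)) c (x \<bullet> c))"
      unfolding tensor_def by (subst prod.remove[OF _ that]) auto
    also have "(\<Prod>c\<in>Basis - {b}. (u(b := u' b)) c (x \<bullet> c)) = (\<Prod>c\<in>Basis - {b}. u c (x \<bullet> c))"
      by (intro prod.cong) auto
    finally show ?thesis by (simp only: mult.assoc)
  qed
  ultimately show ?thesis by (simp cong: sum.cong)
qed

text \<open>A partial derivative of a tensor product replaces one factor by its derivative and is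
  again a tensor product. Smoothness, and later the Schwartz bounds, thereby become statements about
  functions of one variable.\<close>

lemma iter_partial_tensor:
  fixes u :: "'a::euclidean_space \<Rightarrow> real \<Rightarrow> real"
  assumes "\<And>b. b \<in> Basis \<Longrightarrow> all_derivs Q (u b)" "set vs \<subseteq> Basis"
  shows "\<exists>w. (\<forall>b\<in>Basis. all_derivs Q (w b)) \<and> iter_partial vs (tensor u) = tensor w"
  using assms(2)
proof (induction vs)
  case Nil
  show ?case using assms(1) by (intro exI[of _ u]) auto
next
  case (Cons v vs)
  then obtain w where w: "\<forall>b\<in>Basis. all_derivs Q (w b)" "iter_partial vs (tensor u) = tensor w" by auto
  have "\<forall>b\<in>Basis. \<exists>w'. (\<forall>t. (w b has_real_derivative w' t) (at t)) \<and> all_derivs Q w'"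
    using w(1) all_derivs_step by blast
  then obtain w' where w': "\<And>b t. b \<in> Basis \<Longrightarrow> (w b has_real_derivative w' b t) (at t)" "\<And>b. b \<in> Basis \<Longrightarrow> all_derivs Q (w' b)"
    by metis
  have "frechet_derivative (tensor w) (at x) v = tensor (w(v := w' v)) x" for x
  proof -
    have "frechet_derivative (tensor w) (at x) = (\<lambda>y. \<Sum>b\<in>Basis. (y \<bullet> b) * tensor (w(b := w' b)) x)"
      by (rule frechet_derivative_at[symmetric]) (rule tensor_has_derivative[OF w'(1)])
    then have "frechet_derivative (tensor w) (at x) v = (\<Sum>b\<in>Basis. (v \<bullet> b) * tensor (w(b := w' b)) x)" by simp
    also have "\<dots> = (\<Sum>b\<in>Basis. if b = v then tensor (w(b := w' b)) x else 0)"
      using Cons.prems by (intro sum.cong) (auto simp: inner_Basis)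
    also have "\<dots> = tensor (w(v := w' v)) x" using Cons.prems by simp
    finally show ?thesis .
  qed
  then show ?case using w w' by (intro exI[of _ "w(v := w' v)"]) (auto simp: fun_upd_def)
qed

lemma smooth_tensor:
  fixes u :: "'a::euclidean_space \<Rightarrow> real \<Rightarrow> real"
  assumes "\<And>b. b \<in> Basis \<Longrightarrow> all_derivs Q (u b)"
  shows "smooth (tensor u)"
  unfolding smooth_def
proof (intro allI impI)
  fix vs :: "'a list" and x :: 'a assume "set vs \<subseteq> Basis"
  then obtain w where w: "\<forall>b\<in>Basis. all_derivs Q (w b)" "iter_partial vs (tensor u) = tensor w"
    using iter_partial_tensor assms by metis
  have "\<forall>b\<in>Basis. \<exists>w'. (\<forall>t. (w b has_real_derivative w' t) (at t))"
    using w(1) all_derivs_step by blast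
  then obtain w' where w': "\<And>b t. b \<in> Basis \<Longrightarrow> (w b has_real_derivative w' b t) (at t)" by metis
  show "iter_partial vs (tensor u) differentiable at x"
    unfolding w(2) differentiable_def using tensor_has_derivative[of w w' x, OF w'] by (intro exI)
qed

text \<open>Expanding the product yields, among other nonnegative terms, 1 and every |x_b|, while
  the norm is at most the sum of the |x_b|. The lemma serves to distribute a radial weight over the
  coordinates.\<close>

lemma norm_le_prod_coords: "1 + norm (x::'a::euclidean_space) \<le> (\<Prod>b\<in>Basis. 1 + \<bar>x \<bullet> b\<bar>)"
proof -
  have "1 + (\<Sum>b\<in>B. \<bar>x \<bullet> b\<bar>) \<le> (\<Prod>b\<in>B. 1 + \<bar>x \<bullet> b\<bar>)" if "finite B" for B
    using that
  proof induction
    case (insert b B)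
    have "1 + (\<Sum>b\<in>insert b B. \<bar>x \<bullet> b\<bar>) \<le> (1 + \<bar>x \<bullet> b\<bar>) * (1 + (\<Sum>b\<in>B. \<bar>x \<bullet> b\<bar>))"
      using insert by (simp add: algebra_simps sum_nonneg)
    also have "\<dots> \<le> (1 + \<bar>x \<bullet> b\<bar>) * (\<Prod>b\<in>B. 1 + \<bar>x \<bullet> b\<bar>)" by (intro mult_left_mono insert) auto
    finally show ?case using insert by simp
  qed simp
  from this[OF finite_Basis] show ?thesis using norm_le_l1[of x] by linarith
qed

lemma tensor_rapid:
  fixes w :: "'a::euclidean_space \<Rightarrow> real \<Rightarrow> real"
  assumes "\<And>b. b \<in> Basis \<Longrightarrow> rapid (w b)"
  shows "bounded (range (\<lambda>x. norm x ^ m * tensor w x))"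
proof -
  have "\<forall>b\<in>Basis. \<exists>C. \<forall>t. (1 + \<bar>t\<bar>) ^ m * \<bar>w b t\<bar> \<le> C" using assms unfolding rapid_def by blast
  then obtain C where C: "\<And>b t. b \<in> Basis \<Longrightarrow> (1 + \<bar>t\<bar>) ^ m * \<bar>w b t\<bar> \<le> C b" by metis
  have "norm (norm x ^ m * tensor w x) \<le> (\<Prod>b\<in>Basis. C b)" for x
  proof -
    have "norm (norm x ^ m * tensor w x) = norm x ^ m * (\<Prod>b\<in>Basis. \<bar>w b (x \<bullet> b)\<bar>)"
      by (simp add: abs_mult tensor_def abs_prod)
    also have "\<dots> \<le> (\<Prod>b\<in>Basis. 1 + \<bar>x \<bullet> b\<bar>) ^ m * (\<Prod>b\<in>Basis. \<bar>w b (x \<bullet> b)\<bar>)"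
      using norm_le_prod_coords[of x] by (intro mult_right_mono power_mono prod_nonneg) auto
    also have "\<dots> = (\<Prod>b\<in>Basis. (1 + \<bar>x \<bullet> b\<bar>) ^ m * \<bar>w b (x \<bullet> b)\<bar>)"
      by (simp add: prod_power_distrib prod.distrib)
    also have "\<dots> \<le> (\<Prod>b\<in>Basis. C b)" by (intro prod_mono) (auto intro: C)
    finally show ?thesis .
  qed
  then show ?thesis by (auto simp: bounded_iff)
qed

lemma schwartz_tensor:
  fixes u :: "'a::euclidean_space \<Rightarrow> real \<Rightarrow> real"
  assumes "\<And>b. b \<in> Basis \<Longrightarrow> all_derivs rapid (u b)"
  shows "schwartz (tensor u)"
  unfolding schwartz_def
proof (intro conjI allI impI)
  show "smooth (tensor u)" by (rule smooth_tensor[OF assms])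
  fix vs :: "'a list" and m assume "set vs \<subseteq> Basis"
  then obtain w where w: "\<forall>b\<in>Basis. all_derivs rapid (w b)" "iter_partial vs (tensor u) = tensor w"
    using iter_partial_tensor assms by metis
  then show "bounded (range (\<lambda>x. norm x ^ m * iter_partial vs (tensor u) x))"
    by (auto intro!: tensor_rapid dest: all_derivsD)
qed

text \<open>Lebesgue measure on the space is the image of the product measure under the coordinate
  map, so this is Fubini for a product integrand.\<close>

lemma
  fixes w :: "'a::euclidean_space \<Rightarrow> real \<Rightarrow> 'b::{real_normed_field,banach,second_countable_topology}"
  assumes w: "\<And>b. b \<in> Basis \<Longrightarrow> integrable lborel (w b)"
  shows integrable_tensor: "integrable lborel (tensor w)"
    and integral_tensor: "(\<integral>x. tensor w x \<partial>lborel) = (\<Prod>b\<in>Basis. \<integral>t. w b t \<partial>lborel)"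
proof -
  interpret product_sigma_finite "\<lambda>_::'a. lborel :: real measure" ..
  have [measurable]: "w b \<in> borel_measurable borel" if "b \<in> Basis" for b
    using w[OF that] by (simp add: integrable_iff_bounded)
  have T[measurable]: "tensor w \<in> borel_measurable borel"
    unfolding tensor_def[abs_def] by measurable
  have M: "(\<lambda>f. \<Sum>b\<in>Basis. f b *\<^sub>R b) \<in> (\<Pi>\<^sub>M b\<in>Basis. lborel) \<rightarrow>\<^sub>M (borel :: 'a measure)" by measurable
  have eq: "tensor w (\<Sum>b\<in>Basis. f b *\<^sub>R b) = (\<Prod>b\<in>Basis. w b (f b))" for f
    by (simp add: tensor_def inner_sum_left inner_Basis if_distrib cong: if_cong prod.cong)
  show "integrable lborel (tensor w)"
    by (subst lborel_eq, subst integrable_distr_eq[OF M T])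
       (simp add: eq, intro product_integrable_prod w finite_Basis)
  show "(\<integral>x. tensor w x \<partial>lborel) = (\<Prod>b\<in>Basis. \<integral>t. w b t \<partial>lborel)"
    by (subst lborel_eq, subst integral_distr[OF M T])
       (simp add: eq, intro product_integral_prod w finite_Basis)
qed

text \<open>The exponent \<alpha> is meant for p and p - 1, the weight for the multiplier of order
  s. Since \<alpha> may be small, the order m of decay is chosen with m \<alpha> at least r + 2;
  after the weight this still leaves the integrable bound 1 / (1 + t^2).\<close>

lemma rapid_integrable:
  assumes u: "rapid u" "continuous_on UNIV u" and "r \<ge> 0" "\<alpha> > 0"
  shows "integrable lborel (\<lambda>t. (1 + \<bar>t\<bar>) powr r * \<bar>u t\<bar> powr \<alpha>)"
proof -
  obtain m :: nat where m: "real m \<ge> (r + 2) / \<alpha>" using real_arch_simple by blast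
  then have m': "real m * \<alpha> \<ge> r + 2" using \<open>\<alpha> > 0\<close> by (simp add: field_simps)
  obtain C where C: "\<And>t. (1 + \<bar>t\<bar>) ^ m * \<bar>u t\<bar> \<le> C" using u(1) unfolding rapid_def by meson
  have [measurable]: "u \<in> borel_measurable borel" using u(2) by (rule borel_measurable_continuous_onI)
  have "integrable lborel (\<lambda>t::real. inverse (1 + t\<^sup>2))"
    using integrable_inverse_1_plus_square by (simp add: set_integrable_def)
  then have "integrable lborel (\<lambda>t::real. C powr \<alpha> * inverse (1 + t\<^sup>2))" by simp
  then show ?thesis
  proof (rule Bochner_Integration.integrable_bound)
    show "AE t in lborel. norm ((1 + \<bar>t\<bar>) powr r * \<bar>u t\<bar> powr \<alpha>) \<le> norm (C powr \<alpha> * inverse (1 + t\<^sup>2))"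
    proof (rule AE_I2)
      fix t :: real
      have "(1 + \<bar>t\<bar>) powr (r + 2) * \<bar>u t\<bar> powr \<alpha> \<le> (1 + \<bar>t\<bar>) powr (real m * \<alpha>) * \<bar>u t\<bar> powr \<alpha>"
        using m' by (intro mult_right_mono powr_mono) auto
      also have "\<dots> = ((1 + \<bar>t\<bar>) ^ m * \<bar>u t\<bar>) powr \<alpha>"
        by (simp add: powr_mult powr_powr[symmetric] powr_realpow)
      also have "\<dots> \<le> C powr \<alpha>" using C \<open>\<alpha> > 0\<close> by (intro powr_mono2) auto
      finally have 1: "(1 + \<bar>t\<bar>) powr r * \<bar>u t\<bar> powr \<alpha> * (1 + \<bar>t\<bar>)^2 \<le> C powr \<alpha>"
        by (simp add: powr_add powr_realpow[of _ 2, simplified] mult_ac)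
      have "(1 + \<bar>t\<bar>) powr r * \<bar>u t\<bar> powr \<alpha> * (1 + t\<^sup>2) \<le> (1 + \<bar>t\<bar>) powr r * \<bar>u t\<bar> powr \<alpha> * (1 + \<bar>t\<bar>)^2"
        by (intro mult_left_mono) (auto simp: power2_eq_square algebra_simps)
      with 1 have "(1 + \<bar>t\<bar>) powr r * \<bar>u t\<bar> powr \<alpha> * (1 + t\<^sup>2) \<le> C powr \<alpha>" by linarith
      moreover have "1 + t\<^sup>2 > 0" by (simp add: add_pos_nonneg)
      ultimately show "norm ((1 + \<bar>t\<bar>) powr r * \<bar>u t\<bar> powr \<alpha>) \<le> norm (C powr \<alpha> * inverse (1 + t\<^sup>2))"
        by (simp add: field_simps abs_mult)
    qed
  qed measurable
qed

lemma integrable_pair_product: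
  fixes f :: "'a::euclidean_space \<Rightarrow> real" and g :: "'b::euclidean_space \<Rightarrow> real"
  assumes [measurable]: "integrable lborel f" "integrable lborel g"
  shows "integrable (lborel \<Otimes>\<^sub>M lborel) (\<lambda>(x, y). f x * g y)"
proof (rule lborel_pair.Fubini_integrable)
  show "integrable lborel (\<lambda>x. \<integral>y. norm (case (x, y) of (x, y) \<Rightarrow> f x * g y) \<partial>lborel)"
    using assms by (simp add: abs_mult)
qed (use assms in auto)

section \<open>Fourier inversion for even test functions\<close>

lemma rapid_integrable1:
  assumes "all_derivs rapid w" shows "integrable lborel w"
proof -
  have "1 + \<bar>t\<bar> \<noteq> 0" for t :: real by arith
  then have "integrable lborel (\<lambda>t. \<bar>w t\<bar>)"
    using rapid_integrable[OF all_derivsD[OF assms] all_derivs_continuous[OF assms], of 0 1] by simp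
  then show ?thesis
    by (rule Bochner_Integration.integrable_bound) (use all_derivs_measurable[OF assms] in auto)
qed

section \<open>Cosine transforms of compactly supported functions\<close>

lemma integrable_times_cos:
  assumes "integrable lborel w" shows "integrable lborel (\<lambda>x::real. w x * cos (t * x + c) :: real)"
proof (rule Bochner_Integration.integrable_bound[OF assms])
  show "AE x in lborel. norm (w x * cos (t * x + c)) \<le> norm (w x)"
    by (auto simp: abs_mult intro!: mult_left_le)
qed (use assms in measurable)

text \<open>The phase c keeps the family stable: differentiation in t and integration by parts in x
  both shift it by pi/2.\<close>

definition cos_transform :: "(real \<Rightarrow> real) \<Rightarrow> real \<Rightarrow> real \<Rightarrow> real" where
  "cos_transform w c t = (\<integral>x. w x * cos (t * x + c) \<partial>lborel)"

text \<open>Passes to a compact interval, where differentiation under the integral and the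
  fundamental theorem of calculus apply.\<close>

lemma cos_transform_eq:
  assumes "all_derivs supp1 w"
  shows "cos_transform w c t = integral {-1..1} (\<lambda>x. w x * cos (t * x + c))"
proof -
  have w: "integrable lborel w" by (rule rapid_integrable1[OF all_derivs_supp1_rapid[OF assms]])
  have "((\<lambda>x. w x * cos (t * x + c)) has_integral cos_transform w c t) UNIV"
    unfolding cos_transform_def by (rule has_integral_integral_lborel[OF integrable_times_cos[OF w]])
  moreover have "w x = 0" if "x \<notin> {-1..1}" for x
    using all_derivsD[OF assms] that by (auto simp: supp1_def)
  then have "(\<lambda>x. if x \<in> {-1..1} then w x * cos (t * x + c) else 0) = (\<lambda>x. w x * cos (t * x + c))"
    by (intro ext) auto
  ultimately have "((\<lambda>x. w x * cos (t * x + c)) has_integral cos_transform w c t) {-1..1}"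
    by (subst has_integral_restrict_UNIV[symmetric]) simp
  then show ?thesis by (simp add: integral_unique)
qed

text \<open>Differentiating a cosine transform multiplies w by x. The derivative of
  \<open>x * w x\<close> has an additional term without the factor x, so the coinduction runs over
  the larger family \<open>a * (x * v x) + w x\<close>.\<close>

lemma supp1_times_id:
  assumes "all_derivs supp1 w"
  shows "all_derivs supp1 (\<lambda>x. x * w x)"
proof (rule all_derivs_coinduct_set[of _ "{\<lambda>x. a * (x * v x) + w x | a v w. all_derivs supp1 v \<and> all_derivs supp1 w}"])
  have "all_derivs supp1 (\<lambda>x. 0 * w x + 0 * w x)"
    by (rule all_derivs_lincomb[OF _ assms assms]) (auto simp: supp1_def)
  then show "(\<lambda>x. x * w x) \<in> {\<lambda>x. a * (x * v x) + w x | a v w. all_derivs supp1 v \<and> all_derivs supp1 w}"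
    using assms by (intro CollectI exI[of _ 1] exI[of _ w] exI[of _ "\<lambda>_. 0"]) auto
next
  fix y assume "y \<in> {\<lambda>x. a * (x * v x) + w x | a v w. all_derivs supp1 v \<and> all_derivs supp1 w}"
  then obtain a v w where y: "y = (\<lambda>x. a * (x * v x) + w x)" "all_derivs supp1 v" "all_derivs supp1 w" by auto
  show "supp1 y" using y(2,3)[THEN all_derivsD] by (auto simp: y(1) supp1_def)
  obtain v' where v': "\<And>t. (v has_real_derivative v' t) (at t)" "all_derivs supp1 v'" using all_derivs_step[OF y(2)] by blast
  obtain w' where w': "\<And>t. (w has_real_derivative w' t) (at t)" "all_derivs supp1 w'" using all_derivs_step[OF y(3)] by blast
  have "all_derivs supp1 (\<lambda>x. a * v x + 1 * w' x)"
    by (rule all_derivs_lincomb[OF _ y(2) w'(2)]) (auto simp: supp1_def)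
  then have "(\<lambda>x. a * (x * v' x) + (a * v x + 1 * w' x)) \<in> {\<lambda>x. a * (x * v x) + w x | a v w. all_derivs supp1 v \<and> all_derivs supp1 w}"
    using v'(2) by (intro CollectI exI[of _ a] exI[of _ v'] exI[of _ "\<lambda>x. a * v x + 1 * w' x"]) auto
  moreover have "(y has_real_derivative a * (t * v' t) + (a * v t + 1 * w' t)) (at t)" for t
    unfolding y(1) by (auto intro!: derivative_eq_intros v' w' simp: algebra_simps)
  ultimately show "\<exists>y'\<in>{\<lambda>x. a * (x * v x) + w x | a v w. all_derivs supp1 v \<and> all_derivs supp1 w}. \<forall>t. (y has_real_derivative y' t) (at t)"
    by (intro bexI[of _ "\<lambda>x. a * (x * v' x) + (a * v x + 1 * w' x)"]) auto
qed

lemma DERIV_cos_transform: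
  assumes w: "all_derivs supp1 w"
  shows "(cos_transform w c has_real_derivative cos_transform (\<lambda>x. x * w x) (c + pi/2) t) (at t)"
proof -
  have cw: "continuous_on A w" for A by (rule all_derivs_continuous[OF w])
  have "((\<lambda>t. integral (cbox (-1) 1) (\<lambda>x. w x * cos (t * x + c))) has_real_derivative
      integral (cbox (-1) 1) (\<lambda>x. x * w x * cos (t * x + (c + pi/2)))) (at t within UNIV)"
  proof (rule leibniz_rule_field_derivative)
    show "((\<lambda>t. w x * cos (t * x + c)) has_real_derivative x * w x * cos (t * x + (c + pi/2))) (at t within UNIV)" for x t
      by (auto intro!: derivative_eq_intros simp: cos_add sin_add algebra_simps)
    show "(\<lambda>x. w x * cos (t * x + c)) integrable_on cbox (- 1) 1" for t
      by (intro integrable_continuous continuous_intros cw)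
    show "continuous_on (UNIV \<times> cbox (- 1) 1) (\<lambda>(t, x). x * w x * cos (t * x + (c + pi / 2)))"
      unfolding split_beta by (intro continuous_intros continuous_on_compose2[OF cw[of UNIV]]) auto
  qed auto
  then show ?thesis
    by (simp add: cos_transform_eq[OF w, abs_def] cos_transform_eq[OF supp1_times_id[OF w]])
qed

lemma cos_transform_by_parts:
  assumes w: "all_derivs supp1 w" "all_derivs supp1 w'" "\<And>x. (w has_real_derivative w' x) (at x)"
  shows "t * cos_transform w c t = cos_transform w' (c + pi/2) t"
proof -
  have "((\<lambda>x. t * (w x * cos (t * x + c)) - w' x * cos (t * x + (c + pi/2))) has_integral
      (w 1 * sin (t * 1 + c) - w (-1) * sin (t * (-1) + c))) {-1..1}"
  proof (rule fundamental_theorem_of_calculus)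
    show "((\<lambda>x. w x * sin (t * x + c)) has_vector_derivative t * (w x * cos (t * x + c)) - w' x * cos (t * x + (c + pi / 2))) (at x within {- 1..1})" for x
      unfolding has_real_derivative_iff_has_vector_derivative[symmetric]
      by (auto intro!: derivative_eq_intros DERIV_subset[OF w(3)] simp: cos_add sin_add algebra_simps)
  qed simp
  moreover have "w 1 = 0" "w (-1) = 0" using all_derivsD[OF w(1)] by (auto simp: supp1_def)
  ultimately have "integral {-1..1} (\<lambda>x. t * (w x * cos (t * x + c)) - w' x * cos (t * x + (c + pi/2))) = 0"
    by (simp add: integral_unique)
  also have "integral {-1..1} (\<lambda>x. t * (w x * cos (t * x + c)) - w' x * cos (t * x + (c + pi/2)))
     = integral {-1..1} (\<lambda>x. t * (w x * cos (t * x + c))) - integral {-1..1} (\<lambda>x. w' x * cos (t * x + (c + pi/2)))"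
    by (intro Henstock_Kurzweil_Integration.integral_diff integrable_continuous_interval continuous_intros all_derivs_continuous[OF w(1)] all_derivs_continuous[OF w(2)])
  finally show ?thesis by (simp add: cos_transform_eq w)
qed

text \<open>Integration by parts trades one factor t for a derivative of w and a shift of c. The
  induction on m therefore generalises over both, and each step splits
  \<open>1 + \<bar>t\<bar>\<close> into its two summands.\<close>

lemma rapid_cos_transform:
  assumes "all_derivs supp1 w" shows "rapid (cos_transform w c)"
  unfolding rapid_def
proof
  fix m show "\<exists>C. \<forall>t. (1 + \<bar>t\<bar>) ^ m * \<bar>cos_transform w c t\<bar> \<le> C"
    using assms
  proof (induction m arbitrary: w c)
    case 0
    have w: "integrable lborel w" by (rule rapid_integrable1[OF all_derivs_supp1_rapid[OF 0]])
    have "\<bar>cos_transform w c t\<bar> \<le> (\<integral>x. \<bar>w x\<bar> \<partial>lborel)" for t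
    proof -
      have "\<bar>cos_transform w c t\<bar> \<le> (\<integral>x. \<bar>w x * cos (t * x + c)\<bar> \<partial>lborel)"
        unfolding cos_transform_def by (rule integral_abs_bound)
      also have "\<dots> \<le> (\<integral>x. \<bar>w x\<bar> \<partial>lborel)"
        by (intro integral_mono integrable_abs integrable_times_cos w) (auto simp: abs_mult intro!: mult_left_le)
      finally show ?thesis .
    qed
    then show ?case by auto
  next
    case (Suc m)
    obtain w' where w': "\<And>t. (w has_real_derivative w' t) (at t)" "all_derivs supp1 w'"
      using all_derivs_step[OF Suc.prems] by blast
    obtain C where C: "\<And>t. (1 + \<bar>t\<bar>) ^ m * \<bar>cos_transform w c t\<bar> \<le> C" using Suc.IH[OF Suc.prems] by blast
    obtain D where D: "\<And>t. (1 + \<bar>t\<bar>) ^ m * \<bar>cos_transform w' (c + pi/2) t\<bar> \<le> D" using Suc.IH[OF w'(2)] by blast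
    have "(1 + \<bar>t\<bar>) ^ Suc m * \<bar>cos_transform w c t\<bar> \<le> C + D" for t
    proof -
      have "(1 + \<bar>t\<bar>) ^ Suc m * \<bar>cos_transform w c t\<bar> =
        (1 + \<bar>t\<bar>) ^ m * \<bar>cos_transform w c t\<bar> + (1 + \<bar>t\<bar>) ^ m * \<bar>t * cos_transform w c t\<bar>"
        by (simp add: abs_mult algebra_simps)
      also have "\<dots> \<le> C + D"
        using C D unfolding cos_transform_by_parts[OF Suc.prems w'(2,1)] by (rule add_mono)
      finally show ?thesis .
    qed
    then show ?case by blast
  qed
qed

lemma all_derivs_cos_transform:
  assumes "all_derivs supp1 w" shows "all_derivs rapid (cos_transform w c)"
proof (rule all_derivs_coinduct_set[of _ "{cos_transform w c | w c. all_derivs supp1 w}"])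
  fix y assume "y \<in> {cos_transform w c | w c. all_derivs supp1 w}"
  then obtain w c where y: "y = cos_transform w c" "all_derivs supp1 w" by auto
  show "rapid y" using y rapid_cos_transform by simp
  show "\<exists>y'\<in>{cos_transform w c | w c. all_derivs supp1 w}. \<forall>t. (y has_real_derivative y' t) (at t)"
    using y(1) DERIV_cos_transform[OF y(2)] supp1_times_id[OF y(2)]
    by (intro bexI[of _ "cos_transform (\<lambda>x. x * w x) (c + pi/2)"]) auto
qed (use assms in auto)

section \<open>Gaussian summation and cosine inversion\<close>

lemma integral_std_normal_cos:
  "integrable lborel std_normal_density" "(\<integral>z. std_normal_density z * cos (t * z) \<partial>lborel) = exp (- t\<^sup>2 / 2)"
proof -
  show i: "integrable lborel std_normal_density" by simp
  have "exp (- t\<^sup>2 / 2) = Re (char std_normal_distribution t)"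
    by (simp add: char_std_normal_distribution)
  also have "\<dots> = Re (\<integral>z. complex_of_real (std_normal_density z) * iexp (t * z) \<partial>lborel)"
    unfolding char_def by (subst integral_density) (auto simp: scaleR_conv_of_real)
  also have "\<dots> = (\<integral>z. Re (complex_of_real (std_normal_density z) * iexp (t * z)) \<partial>lborel)"
  proof (rule integral_Re[symmetric])
    show "complex_integrable lborel (\<lambda>z. complex_of_real (std_normal_density z) * iexp (t * z))"
      by (rule Bochner_Integration.integrable_bound[OF i]) (auto simp: norm_mult)
  qed
  also have "\<dots> = (\<integral>z. std_normal_density z * cos (t * z) \<partial>lborel)"
    by (simp add: Re_exp)
  finally show "(\<integral>z. std_normal_density z * cos (t * z) \<partial>lborel) = exp (- t\<^sup>2 / 2)" ..
qed

lemma gauss_mollifier: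
  assumes "all_derivs supp1 w" "\<delta> > 0"
  shows "(\<integral>y. w y * exp (- ((y - x) / \<delta>)\<^sup>2 / 2) \<partial>lborel) = \<delta> * sqrt (2 * pi) * (\<integral>z. w (x + \<delta> * z) * std_normal_density z \<partial>lborel)"
  using lborel_integral_real_affine[of \<delta> "\<lambda>y. w y * exp (- ((y - x) / \<delta>)\<^sup>2 / 2)" x] assms(2)
  by (simp add: std_normal_density_def divide_simps)

lemma gauss_mollifier_tendsto:
  assumes w: "all_derivs supp1 w"
  shows "(\<lambda>n. \<integral>z. w (x + (1 / real (Suc n)) * z) * std_normal_density z \<partial>lborel) \<longlonglongrightarrow> w x"
proof -
  obtain C where C: "\<And>t. (1 + \<bar>t\<bar>) ^ 0 * \<bar>w t\<bar> \<le> C"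
    using all_derivsD[OF all_derivs_supp1_rapid[OF w]] unfolding rapid_def by meson
  have [measurable]: "w \<in> borel_measurable borel" using w by (rule all_derivs_measurable)
  have "(\<lambda>n. \<integral>z. w (x + (1 / real (Suc n)) * z) * std_normal_density z \<partial>lborel) \<longlonglongrightarrow> (\<integral>z. w x * std_normal_density z \<partial>lborel)"
  proof (rule integral_dominated_convergence[of _ _ _ "\<lambda>z. C * std_normal_density z"])
    show "AE z in lborel. (\<lambda>n. w (x + (1 / real (Suc n)) * z) * std_normal_density z) \<longlonglongrightarrow> w x * std_normal_density z"
    proof (intro AE_I2 tendsto_intros)
      fix z
      have "(\<lambda>n. x + (1 / real (Suc n)) * z) \<longlonglongrightarrow> x + 0 * z"
        by (intro tendsto_intros LIMSEQ_Suc[OF lim_1_over_n])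
      moreover have "isCont w x" using all_derivs_continuous[OF w, of UNIV] by (simp add: continuous_on_eq_continuous_at)
      ultimately show "(\<lambda>n. w (x + (1 / real (Suc n)) * z)) \<longlonglongrightarrow> w x"
        by (auto intro: isCont_tendsto_compose)
    qed
    show "AE z in lborel. norm (w (x + (1 / real (Suc n)) * z) * std_normal_density z) \<le> C * std_normal_density z" for n
      using C by (auto simp: abs_mult intro!: mult_right_mono)
  qed auto
  then show ?thesis by simp
qed

text \<open>Gauss summation: insert \<open>exp (-(\<delta>\<xi>)\<^sup>2/2)\<close>, apply Fubini, and let \<open>\<delta>\<close> tend to 0 on both sides.\<close>

lemma cos_inversion:
  assumes w: "all_derivs supp1 w" and even: "\<And>x. w (- x) = w x"
  shows "(\<integral>\<xi>. cos_transform w 0 \<xi> * cos (\<xi> * x) \<partial>lborel) = 2 * pi * w x"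
proof -
  let ?v = "cos_transform w 0"
  have v: "integrable lborel ?v" by (rule rapid_integrable1[OF all_derivs_cos_transform[OF w]])
  have wi: "integrable lborel w" by (rule rapid_integrable1[OF all_derivs_supp1_rapid[OF w]])
  have [measurable]: "w \<in> borel_measurable borel" "?v \<in> borel_measurable borel"
    using all_derivs_measurable[OF w] all_derivs_measurable[OF all_derivs_cos_transform[OF w]] by auto
  define I where "I \<delta> = (\<integral>\<xi>. ?v \<xi> * cos (\<xi> * x) * exp (- (\<delta> * \<xi>)\<^sup>2 / 2) \<partial>lborel)" for \<delta>
  \<comment> \<open>The product \<open>cos (\<xi> * y) * cos (\<xi> * x)\<close> is half a sum of
    cosines with frequencies y - x and y + x, so the Gaussian appears centred at x and at -x.
    Evenness of w merges the two contributions after the limit.\<close>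
  have I: "I \<delta> = pi * ((\<integral>z. w (x + \<delta> * z) * std_normal_density z \<partial>lborel) + (\<integral>z. w (- x + \<delta> * z) * std_normal_density z \<partial>lborel))"
    if \<delta>: "\<delta> > 0" for \<delta>
  proof -
    have gi: "integrable lborel (\<lambda>\<xi>. exp (- (\<delta> * \<xi>)\<^sup>2 / 2))"
    proof -
      have "integrable lborel (\<lambda>\<xi>. std_normal_density (0 + \<delta> * \<xi>))"
        using \<delta> by (intro lborel_integrable_real_affine) auto
      from integrable_mult_right[OF this, of "sqrt (2 * pi)"] show ?thesis
        by (simp add: std_normal_density_def)
    qed
    have int: "integrable (lborel \<Otimes>\<^sub>M lborel) (\<lambda>(\<xi>, y). w y * cos (\<xi> * y) * (cos (\<xi> * x) * exp (- (\<delta> * \<xi>)\<^sup>2 / 2)))"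
    proof (rule Bochner_Integration.integrable_bound[OF integrable_pair_product[OF gi wi]])
      show "AE p in lborel \<Otimes>\<^sub>M lborel. norm (case p of (\<xi>, y) \<Rightarrow> w y * cos (\<xi> * y) * (cos (\<xi> * x) * exp (- (\<delta> * \<xi>)\<^sup>2 / 2)))
         \<le> norm (case p of (\<xi>, y) \<Rightarrow> exp (- (\<delta> * \<xi>)\<^sup>2 / 2) * w y)"
      proof (intro AE_I2, clarsimp simp: abs_mult)
        fix \<xi> y
        have "\<bar>w y\<bar> * \<bar>cos (\<xi> * y)\<bar> * (\<bar>cos (\<xi> * x)\<bar> * exp (- ((\<delta> * \<xi>)\<^sup>2 / 2))) \<le> \<bar>w y\<bar> * 1 * (1 * exp (- ((\<delta> * \<xi>)\<^sup>2 / 2)))"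
          by (intro mult_mono) auto
        then show "\<bar>w y\<bar> * \<bar>cos (\<xi> * y)\<bar> * (\<bar>cos (\<xi> * x)\<bar> * exp (- ((\<delta> * \<xi>)\<^sup>2 / 2))) \<le> exp (- ((\<delta> * \<xi>)\<^sup>2 / 2)) * \<bar>w y\<bar>"
          by (simp add: mult.commute)
      qed
    qed measurable
    have "I \<delta> = (\<integral>\<xi>. \<integral>y. w y * cos (\<xi> * y) * (cos (\<xi> * x) * exp (- (\<delta> * \<xi>)\<^sup>2 / 2)) \<partial>lborel \<partial>lborel)"
      unfolding I_def cos_transform_def
      by (intro Bochner_Integration.integral_cong refl, subst integral_mult_left_zero) (simp add: mult.assoc)
    also have "\<dots> = (\<integral>y. \<integral>\<xi>. w y * cos (\<xi> * y) * (cos (\<xi> * x) * exp (- (\<delta> * \<xi>)\<^sup>2 / 2)) \<partial>lborel \<partial>lborel)"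
      by (rule lborel_pair.Fubini_integral[symmetric]) (use int in simp)
    also have "\<dots> = (\<integral>y. w y * (sqrt (2 * pi) / (2 * \<delta>) * (exp (- ((y - x) / \<delta>)\<^sup>2 / 2) + exp (- ((y - (- x)) / \<delta>)\<^sup>2 / 2))) \<partial>lborel)"
    proof (intro Bochner_Integration.integral_cong refl)
      fix y
      have "(\<integral>\<xi>. cos (\<xi> * y) * (cos (\<xi> * x) * exp (- (\<delta> * \<xi>)\<^sup>2 / 2)) \<partial>lborel)
         = (1 / \<delta>) * (\<integral>z. cos (z / \<delta> * y) * (cos (z / \<delta> * x) * exp (- z\<^sup>2 / 2)) \<partial>lborel)"
        using lborel_integral_real_affine[of "1 / \<delta>" "\<lambda>\<xi>. cos (\<xi> * y) * (cos (\<xi> * x) * exp (- (\<delta> * \<xi>)\<^sup>2 / 2))" 0] \<delta>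
        by simp
      also have "(\<integral>z. cos (z / \<delta> * y) * (cos (z / \<delta> * x) * exp (- z\<^sup>2 / 2)) \<partial>lborel)
        = (\<integral>z. sqrt (2 * pi) / 2 * (std_normal_density z * cos ((y - x) / \<delta> * z) + std_normal_density z * cos ((y - (- x)) / \<delta> * z)) \<partial>lborel)"
      proof (intro Bochner_Integration.integral_cong refl)
        fix z
        have "cos ((y - x) / \<delta> * z) + cos ((y - (- x)) / \<delta> * z) = 2 * (cos (z / \<delta> * y) * cos (z / \<delta> * x))"
          by (simp add: diff_divide_distrib add_divide_distrib algebra_simps cos_add cos_diff)
        moreover have "sqrt (2 * pi) / 2 * (std_normal_density z * cos ((y - x) / \<delta> * z) + std_normal_density z * cos ((y - (- x)) / \<delta> * z))
          = exp (- z\<^sup>2 / 2) / 2 * (cos ((y - x) / \<delta> * z) + cos ((y - (- x)) / \<delta> * z))"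
          unfolding std_normal_density_def by (simp add: field_simps)
        ultimately show "cos (z / \<delta> * y) * (cos (z / \<delta> * x) * exp (- z\<^sup>2 / 2)) =
           sqrt (2 * pi) / 2 * (std_normal_density z * cos ((y - x) / \<delta> * z) + std_normal_density z * cos ((y - (- x)) / \<delta> * z))"
          by simp
      qed
      also have "\<dots> = sqrt (2 * pi) / 2 * (exp (- ((y - x) / \<delta>)\<^sup>2 / 2) + exp (- ((y - (- x)) / \<delta>)\<^sup>2 / 2))"
        using integrable_times_cos[OF integral_std_normal_cos(1), of _ 0]
        by (subst integral_mult_right_zero, subst Bochner_Integration.integral_add)
           (simp_all only: integral_std_normal_cos add_0_right)
      finally have "(\<integral>\<xi>. cos (\<xi> * y) * (cos (\<xi> * x) * exp (- (\<delta> * \<xi>)\<^sup>2 / 2)) \<partial>lborel) =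
        sqrt (2 * pi) / (2 * \<delta>) * (exp (- ((y - x) / \<delta>)\<^sup>2 / 2) + exp (- ((y - (- x)) / \<delta>)\<^sup>2 / 2))" by simp
      then show "(\<integral>\<xi>. w y * cos (\<xi> * y) * (cos (\<xi> * x) * exp (- (\<delta> * \<xi>)\<^sup>2 / 2)) \<partial>lborel) =
        w y * (sqrt (2 * pi) / (2 * \<delta>) * (exp (- ((y - x) / \<delta>)\<^sup>2 / 2) + exp (- ((y - (- x)) / \<delta>)\<^sup>2 / 2)))"
        by (simp add: mult.assoc)
    qed
    also have "\<dots> = (\<integral>y. sqrt (2 * pi) / (2 * \<delta>) * (w y * exp (- ((y - x) / \<delta>)\<^sup>2 / 2) + w y * exp (- ((y - (- x)) / \<delta>)\<^sup>2 / 2)) \<partial>lborel)"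
      by (intro Bochner_Integration.integral_cong refl) (simp add: algebra_simps)
    also have "\<dots> = sqrt (2 * pi) / (2 * \<delta>) * ((\<integral>y. w y * exp (- ((y - x) / \<delta>)\<^sup>2 / 2) \<partial>lborel) + (\<integral>y. w y * exp (- ((y - (- x)) / \<delta>)\<^sup>2 / 2) \<partial>lborel))"
    proof -
      have i: "integrable lborel (\<lambda>y. w y * exp (- ((y - a) / \<delta>)\<^sup>2 / 2))" for a
        by (rule Bochner_Integration.integrable_bound[OF wi]) (auto simp: abs_mult intro!: mult_left_le)
      show ?thesis by (subst integral_mult_right_zero, subst Bochner_Integration.integral_add[OF i i]) (rule refl)
    qed
    also have "\<dots> = (sqrt (2 * pi) * sqrt (2 * pi)) / 2 * ((\<integral>z. w (x + \<delta> * z) * std_normal_density z \<partial>lborel) + (\<integral>z. w (- x + \<delta> * z) * std_normal_density z \<partial>lborel))"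
    proof -
      have "c / (2 * \<delta>) * (\<delta> * c * A + \<delta> * c * B) = c * c / 2 * (A + B)" for c A B
        using \<delta> by (simp add: field_simps)
      then show ?thesis unfolding gauss_mollifier[OF w \<delta>] by blast
    qed
    finally show ?thesis by simp
  qed
  have "(\<lambda>n. I (1 / real (Suc n))) \<longlonglongrightarrow> pi * (w x + w (- x))"
    by (subst I) (simp, intro tendsto_intros gauss_mollifier_tendsto[OF w])
  moreover have "(\<lambda>n. I (1 / real (Suc n))) \<longlonglongrightarrow> (\<integral>\<xi>. ?v \<xi> * cos (\<xi> * x) \<partial>lborel)"
    unfolding I_def
  proof (rule integral_dominated_convergence[of _ _ _ "\<lambda>\<xi>. \<bar>?v \<xi>\<bar>"])
    show "AE \<xi> in lborel. (\<lambda>n. ?v \<xi> * cos (\<xi> * x) * exp (- (1 / real (Suc n) * \<xi>)\<^sup>2 / 2)) \<longlonglongrightarrow> ?v \<xi> * cos (\<xi> * x)"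
    proof (intro AE_I2)
      fix \<xi>
      have "(\<lambda>n. ?v \<xi> * cos (\<xi> * x) * exp (- (1 / real (Suc n) * \<xi>)\<^sup>2 / 2)) \<longlonglongrightarrow> ?v \<xi> * cos (\<xi> * x) * exp (- (0 * \<xi>)\<^sup>2 / 2)"
        by (intro tendsto_intros LIMSEQ_Suc[OF lim_1_over_n]) auto
      then show "(\<lambda>n. ?v \<xi> * cos (\<xi> * x) * exp (- (1 / real (Suc n) * \<xi>)\<^sup>2 / 2)) \<longlonglongrightarrow> ?v \<xi> * cos (\<xi> * x)" by simp
    qed
    show "AE \<xi> in lborel. norm (?v \<xi> * cos (\<xi> * x) * exp (- (1 / real (Suc n) * \<xi>)\<^sup>2 / 2)) \<le> \<bar>?v \<xi>\<bar>" for n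
      by (auto simp: abs_mult mult.assoc intro!: mult_left_le mult_le_one)
  qed (use v in auto)
  ultimately have "(\<integral>\<xi>. ?v \<xi> * cos (\<xi> * x) \<partial>lborel) = pi * (w x + w (- x))"
    by (rule LIMSEQ_unique[symmetric])
  then show ?thesis by (simp add: even)
qed

section \<open>The trigonometric polynomial\<close>

lemma pow_sgn_minus: "pow_sgn r (- y) = - pow_sgn r y"
  by (simp add: pow_sgn_def)

lemma pow_sgn_mult: "pow_sgn r (x * y) = pow_sgn r x * pow_sgn r y"
  by (simp add: pow_sgn_def sgn_mult abs_mult powr_mult)

lemma abs_pow_sgn: "r \<noteq> 1 \<Longrightarrow> \<bar>pow_sgn r y\<bar> = \<bar>y\<bar> powr (r - 1)"
  by (simp add: pow_sgn_def abs_mult sgn_if)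

lemma mult_pow_sgn: "y * pow_sgn r y = \<bar>y\<bar> powr r"
proof (cases "y = 0")
  case False
  then have "\<bar>y\<bar> powr r = \<bar>y\<bar> * \<bar>y\<bar> powr (r - 1)"
    by (simp add: powr_mult_base)
  then show ?thesis by (auto simp: pow_sgn_def sgn_if)
qed (simp add: pow_sgn_def)

lemma continuous_on_pow_sgn [continuous_intros]:
  assumes "r > 1" "continuous_on A f" shows "continuous_on A (\<lambda>x. pow_sgn r (f x))"
proof -
  \<comment> \<open>Splitting into positive and negative parts removes the jump of
    \<open>sgn\<close>: both powers have a positive exponent and are continuous at 0.\<close>
  have "pow_sgn r y = (max y 0) powr (r - 1) - (max (- y) 0) powr (r - 1)" for y
    by (auto simp: pow_sgn_def sgn_if max_def)
  then show ?thesis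
    using assms by (auto intro!: continuous_intros continuous_on_powr')
qed

text \<open>At the origin the difference quotient is |z|^(r-2), which tends to 0 because r > 2;
  negative arguments follow by oddness. The lemma is applied with r = 3p, which exceeds 3.\<close>

lemma DERIV_pow_sgn:
  assumes "r > 2" shows "(pow_sgn r has_real_derivative (r - 1) * \<bar>y\<bar> powr (r - 2)) (at y)"
proof -
  have pos: "(pow_sgn r has_real_derivative (r - 1) * \<bar>y\<bar> powr (r - 2)) (at y)" if "y > 0" for y
  proof -
    have "((\<lambda>y. y powr (r - 1)) has_real_derivative (r - 1) * \<bar>y\<bar> powr (r - 2)) (at y)"
      using that by (auto intro!: derivative_eq_intros)
    then show ?thesis
      by (rule has_field_derivative_transform_within_open[of _ _ _ "{0<..}"]) (use that in \<open>auto simp: pow_sgn_def\<close>)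
  qed
  consider "y > 0" | "y = 0" | "y < 0" by linarith
  then show ?thesis
  proof cases
    case 2
    have "((\<lambda>z::real. \<bar>z\<bar> powr (r - 2)) \<longlongrightarrow> 0) (at 0)"
      using assms by (intro tendsto_zero_powrI[of _ _ _ "r - 2"] tendsto_rabs_zero tendsto_ident_at) auto
    moreover have "\<forall>\<^sub>F z in at 0. \<bar>z\<bar> powr (r - 2) = (pow_sgn r z - pow_sgn r 0) / (z - 0)"
      unfolding eventually_at_filter
    proof (intro always_eventually allI impI)
      fix z :: real assume "z \<noteq> 0"
      then have "\<bar>z\<bar> powr (r - 1) = \<bar>z\<bar> * \<bar>z\<bar> powr (r - 2)" by (simp add: powr_mult_base)
      then show "\<bar>z\<bar> powr (r - 2) = (pow_sgn r z - pow_sgn r 0) / (z - 0)"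
        using \<open>z \<noteq> 0\<close> by (auto simp: pow_sgn_def sgn_if field_simps)
    qed
    ultimately have "((\<lambda>z. (pow_sgn r z - pow_sgn r 0) / (z - 0)) \<longlongrightarrow> 0) (at 0)"
      by (rule Lim_transform_eventually)
    then show ?thesis using 2 by (simp add: has_field_derivative_iff)
  next
    case 3
    have "((\<lambda>z. - pow_sgn r (- z)) has_real_derivative - (((r - 1) * \<bar>- y\<bar> powr (r - 2)) * - 1)) (at y)"
      using 3 by (intro DERIV_minus DERIV_chain2[where f = "pow_sgn r" and g = uminus] pos) (auto intro!: derivative_eq_intros)
    then show ?thesis by (simp add: pow_sgn_minus)
  qed (rule pos)
qed

definition profile :: "real \<Rightarrow> real" where
  "profile t = 4/3 * cos t ^ 3"

text \<open>The multiplier |m|^s applied to \<open>profile\<close>: the term cos (3t) / 3 acquires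
  the factor 3^s.\<close>

definition lap_profile :: "real \<Rightarrow> real \<Rightarrow> real" where
  "lap_profile s t = cos t + 3 powr (s - 1) * cos (3 * t)"

text \<open>With b = 3^(s-1), the constant \<mu> of the mean value computation is negative iff p <
  4b / (3(b+1)) = 1 + (b-3) / (3(b+1)). Half of this excess over 1 is taken, so that the threshold
  itself is admissible; it is positive because s > 2 gives b > 3.\<close>

definition p_max :: "real \<Rightarrow> real" where
  "p_max s = 1 + (3 powr (s - 1) - 3) / (6 * (3 powr (s - 1) + 1))"

lemma cos_triple: "cos (3 * t) = 4 * cos t ^ 3 - 3 * cos (t::real)"
  using cos_treble_cos[of t] by simp

lemma p_max_bounds: assumes "s > 2" shows "1 < p_max s" "p_max s < 7/6"
proof -
  have "(3::real) powr 1 < 3 powr (s - 1)" using assms by (intro powr_less_mono) auto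
  then show "1 < p_max s" "p_max s < 7/6" by (auto simp: p_max_def field_simps)
qed

text \<open>With \<open>A = \<bar>cos t\<bar>\<^bsup>3p-2\<^esup>\<close> the integrand is \<open>K (1 - 3b + 4b cos\<^sup>2 t) A\<close>, and
  \<open>(3p cos\<^sup>2 t - (3p - 1)) A\<close> is the derivative of a periodic function. Modulo this derivative the
  integrand is \<open>K \<mu> A\<close>, where \<open>\<mu>\<close> tends to \<open>1 - b/3 < 0\<close> as \<open>p\<close> tends to 1.\<close>
lemma profile_average_negative:
  assumes "s > 2" "1 < p" "p \<le> p_max s"
  obtains \<kappa> where "\<kappa> > 0"
    "\<And>y. (\<integral>\<theta>. indicator {0..2*pi} \<theta> * (lap_profile s (y + \<theta>) * pow_sgn p (profile (y + \<theta>))) \<partial>lborel) \<le> - \<kappa>"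
proof -
  \<comment> \<open>The number (3p-4)/(3p) is the ratio of the third to the first cosine coefficient
    of \<open>pow_sgn (3 * p - 2) (cos t)\<close>; at p = 1 it equals -1/3.\<close>
  define b K \<mu> where "b = 3 powr (s - 1)" and "K = (4/3::real) powr (p - 1)" and "\<mu> = 1 + b * (3 * p - 4) / (3 * p)"
  have "(3::real) powr 1 < b" unfolding b_def using assms by (intro powr_less_mono) auto
  then have b: "b > 3" by simp
  have p: "p < 7/6" using assms p_max_bounds by force
  have "3 * p * (b + 1) \<le> 3 * (b + 1) + (b - 3) / 2"
    using assms(3) b unfolding p_max_def b_def[symmetric] by (simp add: field_simps)
  then have "3 * p * (b + 1) < 4 * b" using b by argo
  then have \<mu>: "\<mu> < 0" using \<open>1 < p\<close> by (simp add: \<mu>_def field_simps)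
  have K: "K > 0" by (simp add: K_def)
  define h where "h t = lap_profile s t * pow_sgn p (profile t)" for t
  \<comment> \<open>A primitive of the majorant \<open>H'\<close> of \<open>h\<close>. Its first
    summand is periodic, and of the second only \<open>t / 2\<close> grows, so a full period
    contributes K \<mu> pi whatever the starting point.\<close>
  define H where "H t = K * (4 * b / (3 * p) * (sin t * pow_sgn (3 * p) (cos t)) + \<mu> * (t / 2 + sin (2 * t) / 4))" for t
  define H' where "H' t = K * (4 * b / (3 * p) * ((3 * p * cos t ^ 2 - (3 * p - 1)) * \<bar>cos t\<bar> powr (3 * p - 2)) + \<mu> * cos t ^ 2)" for t
  have h: "h t = K * ((1 - 3 * b + 4 * b * cos t ^ 2) * \<bar>cos t\<bar> powr (3 * p - 2))" for t
  proof -
    have "pow_sgn p (cos t ^ 3) = pow_sgn (3 * p - 2) (cos t)"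
    proof -
      have "\<bar>cos t ^ 3\<bar> = \<bar>cos t\<bar> powr 3" by (simp add: power_abs powr_numeral)
      moreover have "3 * (p - 1) = 3 * p - 2 - 1" by simp
      ultimately have "\<bar>cos t ^ 3\<bar> powr (p - 1) = \<bar>cos t\<bar> powr (3 * p - 2 - 1)"
        by (simp only: powr_powr)
      moreover have "sgn (cos t ^ 3) = sgn (cos t)"
        by (auto simp: sgn_if zero_less_power_eq)
      ultimately show ?thesis by (simp only: pow_sgn_def)
    qed
    then have "pow_sgn p (profile t) = K * pow_sgn (3 * p - 2) (cos t)"
      unfolding profile_def pow_sgn_mult by (simp add: K_def pow_sgn_def)
    then have "h t = K * ((1 - 3 * b + 4 * b * cos t ^ 2) * (cos t * pow_sgn (3 * p - 2) (cos t)))"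
      unfolding h_def lap_profile_def cos_triple b_def[symmetric]
      by (simp add: algebra_simps power2_eq_square power3_eq_cube)
    then show ?thesis by (simp add: mult_pow_sgn)
  qed
  \<comment> \<open>As p < 7/6 gives 3p - 2 \<le> 2, the power
    \<open>\<bar>cos t\<bar> powr (3 * p - 2)\<close> is at least cos^2 t. Multiplied by the
    negative \<mu> this is an upper bound, and cos^2 has an elementary primitive.\<close>
  have hH: "h t \<le> H' t" for t
  proof -
    let ?A = "\<bar>cos t\<bar> powr (3 * p - 2)"
    have eq: "(1 - 3 * b + 4 * b * cos t ^ 2) * ?A = 4 * b / (3 * p) * ((3 * p * cos t ^ 2 - (3 * p - 1)) * ?A) + \<mu> * ?A"
      using \<open>1 < p\<close> unfolding \<mu>_def by (simp add: field_simps)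
    have "cos t ^ 2 = \<bar>cos t\<bar> powr 2"
      by (simp add: powr_numeral)
    also have "\<dots> \<le> ?A" using p by (intro powr_mono') auto
    finally have "\<mu> * ?A \<le> \<mu> * cos t ^ 2" using \<mu> by (simp add: mult_left_mono_neg)
    then show ?thesis unfolding h H'_def eq using K by (intro mult_left_mono) auto
  qed
  have HD: "(H has_real_derivative H' t) (at t)" for t
  proof -
    have d: "((\<lambda>t. pow_sgn (3 * p) (cos t)) has_real_derivative ((3 * p - 1) * \<bar>cos t\<bar> powr (3 * p - 2)) * - sin t) (at t)"
      using \<open>1 < p\<close> by (intro DERIV_chain2[OF DERIV_pow_sgn]) (auto intro!: derivative_eq_intros)
    have c2: "cos t * pow_sgn (3 * p) (cos t) = cos t ^ 2 * \<bar>cos t\<bar> powr (3 * p - 2)"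
    proof (cases "cos t = 0")
      case False
      have "\<bar>cos t\<bar> powr (3 * p) = \<bar>cos t\<bar> powr 2 * \<bar>cos t\<bar> powr (3 * p - 2)"
        by (simp only: powr_add[symmetric]) simp
      moreover have "cos t ^ 2 = \<bar>cos t\<bar> powr 2" by (simp add: powr_numeral)
      ultimately show ?thesis by (simp only: mult_pow_sgn)
    qed simp
    have "(H has_real_derivative K * (4 * b / (3 * p) * (cos t * pow_sgn (3 * p) (cos t) + ((3 * p - 1) * \<bar>cos t\<bar> powr (3 * p - 2)) * - sin t * sin t) + \<mu> * (1 / 2 + cos (2 * t) / 2))) (at t)"
      unfolding H_def using \<open>1 < p\<close> by (auto intro!: derivative_eq_intros d)
    moreover have "cos t ^ 2 * A + ((3 * p - 1) * A) * - sin t * sin t = (3 * p * cos t ^ 2 - (3 * p - 1)) * A" for A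
      using sin_cos_squared_add[of t] by algebra
    moreover have "1 / 2 + cos (2 * t) / 2 = cos t ^ 2" using cos_double_cos[of t] by linarith
    ultimately show ?thesis by (simp only: H'_def c2)
  qed
  have hc: "continuous_on UNIV h"
    unfolding h_def lap_profile_def profile_def using \<open>1 < p\<close> by (intro continuous_intros)
  have "(\<integral>\<theta>. indicator {0..2*pi} \<theta> * h (y + \<theta>) \<partial>lborel) \<le> K * \<mu> * pi" for y
  proof -
    have c: "continuous_on {0..2*pi} (\<lambda>\<theta>. h (y + \<theta>))"
      by (intro continuous_on_compose2[OF hc] continuous_intros) auto
    have "(\<integral>\<theta>. indicator {0..2*pi} \<theta> * h (y + \<theta>) \<partial>lborel) = integral {0..2*pi} (\<lambda>\<theta>. h (y + \<theta>))"
      using set_borel_integral_eq_integral(2)[OF borel_integrable_atLeastAtMost'[OF c]]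
      by (simp add: set_lebesgue_integral_def)
    also have "\<dots> \<le> H (y + 2 * pi) - H (y + 0)"
    proof (rule has_integral_le)
      show "((\<lambda>\<theta>. h (y + \<theta>)) has_integral integral {0..2*pi} (\<lambda>\<theta>. h (y + \<theta>))) {0..2*pi}"
        by (intro integrable_integral integrable_continuous_interval c)
      show "((\<lambda>\<theta>. H' (y + \<theta>)) has_integral H (y + 2 * pi) - H (y + 0)) {0..2*pi}"
      proof (rule fundamental_theorem_of_calculus)
        fix \<theta>
        have "((\<lambda>\<theta>. H (y + \<theta>)) has_real_derivative H' (y + \<theta>) * 1) (at \<theta>)"
          by (intro DERIV_chain2[OF HD]) (auto intro!: derivative_eq_intros)
        then show "((\<lambda>\<theta>. H (y + \<theta>)) has_vector_derivative H' (y + \<theta>)) (at \<theta> within {0..2*pi})"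
          by (simp add: has_real_derivative_iff_has_vector_derivative has_vector_derivative_at_within)
      qed simp
    qed (rule hH)
    also have "\<dots> = K * \<mu> * pi"
    proof -
      have "sin (2 * (y + 2 * pi)) = sin (2 * y)"
        using sin_periodic[of "2 * y + 2 * pi"] sin_periodic[of "2 * y"] by (simp add: algebra_simps)
      then show ?thesis unfolding H_def add_0_right sin_periodic cos_periodic by (simp add: algebra_simps)
    qed
    finally show ?thesis .
  qed
  moreover have "- (K * \<mu> * pi) > 0" using K \<mu> by (simp add: mult_less_0_iff)
  ultimately show thesis using that[of "- (K * \<mu> * pi)"] by (simp add: h_def)
qed

text \<open>If every phase failed, integrating over \<theta> in [0, 2 pi] and exchanging the
  integrals would give -2 pi \<kappa>/8 \<le> -\<kappa> up to the positive factor given by the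
  integral of w, that is 2 pi \<ge> 8. The sharp constant is \<kappa>/(2 pi); the 8 merely exceeds 2
  pi.\<close>

lemma exists_shift:
  fixes \<phi> w :: "'a::euclidean_space \<Rightarrow> real" and h :: "real \<Rightarrow> real" and \<kappa> :: real
  assumes h: "continuous_on UNIV h" "\<And>t. \<bar>h t\<bar> \<le> B" and [measurable]: "\<phi> \<in> borel_measurable borel"
    and w: "integrable lborel w" "\<And>x. w x \<ge> 0" "(\<integral>x. w x \<partial>lborel) > 0"
    and "\<kappa> > 0" and avg: "\<And>y. (\<integral>\<theta>. indicator {0..2*pi} \<theta> * h (y + \<theta>) \<partial>lborel) \<le> - \<kappa>"
  shows "\<exists>\<theta>. (\<integral>x. h (\<phi> x + \<theta>) * w x \<partial>lborel) \<le> - (\<kappa> / 8) * (\<integral>x. w x \<partial>lborel)"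
proof (rule ccontr)
  assume "\<not> ?thesis"
  then have *: "(\<integral>x. h (\<phi> x + \<theta>) * w x \<partial>lborel) \<ge> - (\<kappa> / 8) * (\<integral>x. w x \<partial>lborel)" for \<theta>
    by (meson linear)
  let ?I = "indicator {0..2*pi} :: real \<Rightarrow> real"
  let ?W = "\<integral>x. w x \<partial>lborel"
  have [measurable]: "h \<in> borel_measurable borel" "w \<in> borel_measurable borel"
    using h(1) w(1) by (auto intro: borel_measurable_continuous_onI)
  have I: "integrable lborel ?I" by (simp add: integrable_indicator_iff)
  have int: "integrable (lborel \<Otimes>\<^sub>M lborel) (\<lambda>(\<theta>, x). ?I \<theta> * h (\<phi> x + \<theta>) * w x)"
  proof (rule Bochner_Integration.integrable_bound)
    show "integrable (lborel \<Otimes>\<^sub>M lborel) (\<lambda>(\<theta>, x). (B * ?I \<theta>) * w x)"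
      by (rule integrable_pair_product) (use I w in auto)
    show "AE z in lborel \<Otimes>\<^sub>M lborel. norm (case z of (\<theta>, x) \<Rightarrow> ?I \<theta> * h (\<phi> x + \<theta>) * w x) \<le> norm (case z of (\<theta>, x) \<Rightarrow> (B * ?I \<theta>) * w x)"
      using h(2) w(2) order_trans[OF abs_ge_zero h(2)]
      by (intro AE_I2) (auto simp: abs_mult indicator_def intro!: mult_right_mono)
  qed measurable
  have "- (\<kappa> / 8) * ?W * (2 * pi) = (\<integral>\<theta>. ?I \<theta> * (- (\<kappa> / 8) * ?W) \<partial>lborel)"
    by (subst integral_mult_left_zero) simp
  also have "\<dots> \<le> (\<integral>\<theta>. \<integral>x. ?I \<theta> * h (\<phi> x + \<theta>) * w x \<partial>lborel \<partial>lborel)"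
  proof (rule integral_mono)
    show "integrable lborel (\<lambda>\<theta>. ?I \<theta> * (- (\<kappa> / 8) * ?W))" by (intro integrable_mult_left I)
    show "integrable lborel (\<lambda>\<theta>. \<integral>x. ?I \<theta> * h (\<phi> x + \<theta>) * w x \<partial>lborel)"
      using lborel_pair.integrable_fst'[OF int] by simp
    show "?I \<theta> * (- (\<kappa> / 8) * ?W) \<le> (\<integral>x. ?I \<theta> * h (\<phi> x + \<theta>) * w x \<partial>lborel)" for \<theta>
      using mult_left_mono[OF *[of \<theta>], of "?I \<theta>"] by (simp add: mult.assoc)
  qed
  also have "\<dots> = (\<integral>x. \<integral>\<theta>. ?I \<theta> * h (\<phi> x + \<theta>) * w x \<partial>lborel \<partial>lborel)"
    by (rule lborel_pair.Fubini_integral[symmetric]) (use int in simp)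
  also have "\<dots> \<le> (\<integral>x. - \<kappa> * w x \<partial>lborel)"
  proof (rule integral_mono)
    show "integrable lborel (\<lambda>x. \<integral>\<theta>. ?I \<theta> * h (\<phi> x + \<theta>) * w x \<partial>lborel)"
      using lborel_pair.integrable_snd[OF int] by simp
    show "(\<integral>\<theta>. ?I \<theta> * h (\<phi> x + \<theta>) * w x \<partial>lborel) \<le> - \<kappa> * w x" for x
      using mult_right_mono[OF avg[of "\<phi> x"] w(2)[of x]] by simp
  qed (use w in auto)
  also have "\<dots> = - \<kappa> * ?W" by simp
  finally have "\<kappa> * ?W * (2 * pi) \<ge> \<kappa> * ?W * 8" by simp
  moreover have "\<kappa> * ?W > 0" using assms by simp
  ultimately have "2 * pi \<ge> 8" by (simp add: mult_le_cancel_right_pos mult.commute)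
  then show False using pi_less_4 by simp
qed

section \<open>Modulated wave packets\<close>

definition freqs :: "real set" where "freqs = {1, - 1, 3, - 3}"
definition amp :: "real \<Rightarrow> real" where "amp m = (if \<bar>m\<bar> = 1 then 1/2 else 1/6)"

lemma finite_freqs [simp]: "finite freqs" by (simp add: freqs_def)

lemma sum_freqs: "(\<Sum>m\<in>freqs. F m) = F 1 + F (- 1) + F 3 + F (- 3)"
  for F :: "real \<Rightarrow> 'b::comm_monoid_add"
  by (simp add: freqs_def add.assoc)

lemma profile_sum: "complex_of_real (profile t) = (\<Sum>m\<in>freqs. of_real (amp m) * cis (m * t))"
  using cos_triple[of t] by (simp add: sum_freqs amp_def profile_def complex_eq_iff field_simps)

lemma lap_profile_sum:
  "complex_of_real (lap_profile s t) = (\<Sum>m\<in>freqs. of_real (amp m) * of_real (\<bar>m\<bar> powr s) * cis (m * t))"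
  by (simp add: sum_freqs amp_def lap_profile_def complex_eq_iff powr_diff)

lemma cis_sum: "cis (\<Sum>b\<in>B. f b) = (\<Prod>b\<in>B. cis (f b))"
  by (induction B rule: infinite_finite_induct) (auto simp flip: cis_mult)

lemma integrable_times_cis:
  assumes "integrable M w" "\<phi> \<in> borel_measurable M"
  shows "integrable M (\<lambda>x. complex_of_real (w x) * cis (\<phi> x))"
proof (rule Bochner_Integration.integrable_bound[OF assms(1)])
  have "(\<lambda>x. cis (\<phi> x)) \<in> borel_measurable M"
    by (rule measurable_compose[OF assms(2)]) (intro borel_measurable_continuous_onI continuous_intros)
  then show "(\<lambda>x. complex_of_real (w x) * cis (\<phi> x)) \<in> borel_measurable M"
    using assms(1) by measurable
qed (auto simp: norm_mult)

lemma lborel_integral_translate: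
  fixes f :: "'a::euclidean_space \<Rightarrow> 'b::{banach, second_countable_topology}"
  assumes [measurable]: "f \<in> borel_measurable borel"
  shows "(\<integral>x. f (c + x) \<partial>lborel) = (\<integral>x. f x \<partial>lborel)"
proof -
  have "(\<integral>x. f x \<partial>lborel) = (\<integral>x. f x \<partial>distr lborel borel ((+) c))" by (simp add: lborel_distr_plus)
  also have "\<dots> = (\<integral>x. f (c + x) \<partial>lborel)" by (rule integral_distr) auto
  finally show ?thesis ..
qed

lemma lborel_integrable_translate:
  fixes f :: "'a::euclidean_space \<Rightarrow> 'b::{banach, second_countable_topology}"
  assumes "integrable lborel f"
  shows "integrable lborel (\<lambda>x. f (c + x))"
proof -
  have "integrable (distr lborel borel ((+) c)) f" using assms by (simp add: lborel_distr_plus)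
  then show ?thesis by (subst (asm) integrable_distr_eq) (use assms in auto)
qed

text \<open>Abstracts from the two choices of profile: for (i) u has compact support, for (ii) v
  does. Both Fourier integrals are assumed real valued, and inversion is part of the assumptions.
  The value at 0 makes the integrals of the powers of |g| strictly positive.\<close>

locale wave_packet =
  fixes u v :: "real \<Rightarrow> real" and e :: "'a::euclidean_space"
  assumes u: "all_derivs rapid u" and v: "all_derivs rapid v"
    and fourier_u: "\<And>\<tau>. (\<integral>t. complex_of_real (u t) * cis (- (\<tau> * t)) \<partial>lborel) = of_real (v \<tau>)"
    and fourier_v: "\<And>t. (\<integral>\<tau>. complex_of_real (v \<tau>) * cis (\<tau> * t) \<partial>lborel) = of_real (2 * pi * u t)"
    and u0: "u 0 \<noteq> 0" and e: "e \<in> Basis"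
begin

definition g :: "'a \<Rightarrow> real" where "g = tensor (\<lambda>_. u)"
definition gh :: "'a \<Rightarrow> real" where "gh = tensor (\<lambda>_. v)"

definition packet :: "real \<Rightarrow> real \<Rightarrow> 'a \<Rightarrow> real" where
  "packet N \<theta> x = profile (N * (x \<bullet> e) + \<theta>) * g x"

lemma u_measurable[measurable]: "u \<in> borel_measurable borel" and v_measurable[measurable]: "v \<in> borel_measurable borel"
  using u v by (auto intro: all_derivs_measurable)

lemma g_measurable[measurable]: "g \<in> borel_measurable borel" and gh_measurable[measurable]: "gh \<in> borel_measurable borel"
  unfolding g_def gh_def tensor_def[abs_def] by measurable

lemma g_integrable: "integrable lborel g"
  unfolding g_def by (rule integrable_tensor) (rule rapid_integrable1[OF u])

lemma gh_integrable: "integrable lborel gh"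
  unfolding gh_def by (rule integrable_tensor) (rule rapid_integrable1[OF v])

lemma abs_tensor_powr:
  fixes w :: "real \<Rightarrow> real" and x :: 'a
  shows "\<bar>tensor (\<lambda>_. w) x\<bar> powr \<alpha> = tensor (\<lambda>_ t. \<bar>w t\<bar> powr \<alpha>) x"
  by (simp add: tensor_def abs_prod prod_powr_distrib)

lemma g_powr_integrable:
  assumes "\<alpha> > 0" shows "integrable lborel (\<lambda>x. \<bar>g x\<bar> powr \<alpha>)"
proof -
  have "1 + \<bar>t\<bar> \<noteq> 0" for t :: real by arith
  then have "integrable lborel (\<lambda>t. \<bar>u t\<bar> powr \<alpha>)"
    using rapid_integrable[OF all_derivsD[OF u] all_derivs_continuous[OF u], of 0 \<alpha>] assms by simp
  then show ?thesis unfolding g_def abs_tensor_powr by (intro integrable_tensor)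
qed

text \<open>By continuity |u| stays above |u(0)|/2 on a short interval, so the one-dimensional
  integral is positive, and the integral over the whole space is its d-th power.\<close>

lemma g_powr_integral_pos:
  assumes "\<alpha> > 0" shows "(\<integral>x. \<bar>g x\<bar> powr \<alpha> \<partial>lborel) > 0"
proof -
  have "1 + \<bar>t\<bar> \<noteq> 0" for t :: real by arith
  then have i: "integrable lborel (\<lambda>t. \<bar>u t\<bar> powr \<alpha>)"
    using rapid_integrable[OF all_derivsD[OF u] all_derivs_continuous[OF u], of 0 \<alpha>] assms by simp
  have "isCont u 0" using all_derivs_continuous[OF u, of UNIV] by (simp add: continuous_on_eq_continuous_at)
  then have "\<forall>\<^sub>F t in at 0. dist (u t) (u 0) < \<bar>u 0\<bar> / 2"
    using u0 by (intro tendstoD) (auto simp: isCont_def)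
  then obtain r where r: "r > 0" "\<And>t. t \<noteq> 0 \<Longrightarrow> dist t 0 < r \<Longrightarrow> dist (u t) (u 0) < \<bar>u 0\<bar> / 2"
    unfolding eventually_at by auto
  have *: "\<bar>u t\<bar> \<ge> \<bar>u 0\<bar> / 2" if "t \<in> {0..r/2}" for t
  proof (cases "t = 0")
    case False
    then have "\<bar>u t - u 0\<bar> < \<bar>u 0\<bar> / 2" using r that by (auto simp: dist_real_def)
    then show ?thesis by arith
  qed simp
  have "0 < (\<bar>u 0\<bar> / 2) powr \<alpha> * (r / 2)" using r u0 by simp
  also have "\<dots> = (\<integral>t. (\<bar>u 0\<bar> / 2) powr \<alpha> * indicator {0..r/2} t \<partial>lborel)" using r by simp
  also have "\<dots> \<le> (\<integral>t. \<bar>u t\<bar> powr \<alpha> \<partial>lborel)"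
  proof (rule integral_mono)
    show "(\<bar>u 0\<bar> / 2) powr \<alpha> * indicator {0..r/2} t \<le> \<bar>u t\<bar> powr \<alpha>" for t
      using *[of t] assms by (auto simp: indicator_def intro: powr_mono2)
  qed (use i in \<open>auto simp: integrable_indicator_iff emeasure_lborel_Icc_eq\<close>)
  finally show ?thesis
    unfolding g_def abs_tensor_powr by (subst integral_tensor) (use i in auto)
qed

lemma fourier_g: "(\<integral>x. complex_of_real (g x) * cis (- (\<xi> \<bullet> x)) \<partial>lborel) = of_real (gh \<xi>)"
proof -
  have "complex_of_real (g x) * cis (- (\<xi> \<bullet> x)) = tensor (\<lambda>b t. complex_of_real (u t) * cis (- ((\<xi> \<bullet> b) * t))) x" for x
    by (subst euclidean_inner) (simp add: g_def tensor_def prod.distrib cis_sum flip: sum_negf)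
  then have "(\<integral>x. complex_of_real (g x) * cis (- (\<xi> \<bullet> x)) \<partial>lborel) = (\<Prod>b\<in>Basis. \<integral>t. complex_of_real (u t) * cis (- ((\<xi> \<bullet> b) * t)) \<partial>lborel)"
    by (simp, intro integral_tensor integrable_times_cis rapid_integrable1[OF u]) measurable
  then show ?thesis by (simp add: fourier_u gh_def tensor_def)
qed

lemma inverse_fourier_gh: "(\<integral>\<xi>. complex_of_real (gh \<xi>) * cis (\<xi> \<bullet> x) \<partial>lborel) = of_real ((2 * pi) ^ DIM('a) * g x)"
proof -
  have "complex_of_real (gh \<xi>) * cis (\<xi> \<bullet> x) = tensor (\<lambda>b t. complex_of_real (v t) * cis (t * (x \<bullet> b))) \<xi>" for \<xi>
    by (subst euclidean_inner) (simp add: gh_def tensor_def prod.distrib cis_sum)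
  then have "(\<integral>\<xi>. complex_of_real (gh \<xi>) * cis (\<xi> \<bullet> x) \<partial>lborel) = (\<Prod>b\<in>Basis. \<integral>t. complex_of_real (v t) * cis (t * (x \<bullet> b)) \<partial>lborel)"
    by (simp, intro integral_tensor integrable_times_cis rapid_integrable1[OF v]) measurable
  then show ?thesis by (simp add: fourier_v g_def tensor_def prod.distrib)
qed

lemma gh_weighted_integrable:
  assumes "s > 0" shows "integrable lborel (\<lambda>\<xi>. (1 + norm \<xi>) powr s * \<bar>gh \<xi>\<bar>)"
proof -
  have i: "integrable lborel (tensor (\<lambda>_ t. (1 + \<bar>t\<bar>) powr s * \<bar>v t\<bar> powr 1) :: 'a \<Rightarrow> real)"
    by (intro integrable_tensor rapid_integrable all_derivsD[OF v] all_derivs_continuous[OF v]) (use assms in auto)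
  show ?thesis
  proof (rule Bochner_Integration.integrable_bound[OF i])
    show "AE \<xi> in lborel. norm ((1 + norm \<xi>) powr s * \<bar>gh \<xi>\<bar>) \<le> norm (tensor (\<lambda>_ t. (1 + \<bar>t\<bar>) powr s * \<bar>v t\<bar> powr 1) \<xi>)"
    proof (rule AE_I2)
      fix \<xi> :: 'a
      have "(1 + norm \<xi>) powr s * \<bar>gh \<xi>\<bar> \<le> (\<Prod>b\<in>Basis. 1 + \<bar>\<xi> \<bullet> b\<bar>) powr s * \<bar>gh \<xi>\<bar>"
        using norm_le_prod_coords[of \<xi>] assms by (intro mult_right_mono powr_mono2) auto
      also have "(\<Prod>b\<in>Basis. 1 + \<bar>\<xi> \<bullet> b\<bar>) powr s = (\<Prod>b\<in>Basis. (1 + \<bar>\<xi> \<bullet> b\<bar>) powr s)"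
        by (rule prod_powr_distrib)
      finally show "norm ((1 + norm \<xi>) powr s * \<bar>gh \<xi>\<bar>) \<le> norm (tensor (\<lambda>_ t. (1 + \<bar>t\<bar>) powr s * \<bar>v t\<bar> powr 1) \<xi>)"
        by (simp add: gh_def tensor_def abs_prod prod.distrib abs_mult)
    qed
  qed measurable
qed

lemma norm_add_powr_le:
  fixes \<xi> c :: 'a
  assumes "s > 0" shows "norm (\<xi> + c) powr s \<le> (1 + norm c) powr s * (1 + norm \<xi>) powr s"
proof -
  have "norm (\<xi> + c) \<le> norm \<xi> + norm c" by (rule norm_triangle_ineq)
  also have "\<dots> \<le> (1 + norm c) * (1 + norm \<xi>)" by (simp add: algebra_simps)
  finally have "norm (\<xi> + c) powr s \<le> ((1 + norm c) * (1 + norm \<xi>)) powr s" using assms by (intro powr_mono2) auto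
  then show ?thesis by (simp add: powr_mult)
qed

lemma shifted_integrable:
  assumes "s > 0" shows "integrable lborel (\<lambda>\<xi>. norm (\<xi> + c) powr s * gh \<xi>)"
proof (rule Bochner_Integration.integrable_bound)
  show "integrable lborel (\<lambda>\<xi>. (1 + norm c) powr s * ((1 + norm \<xi>) powr s * \<bar>gh \<xi>\<bar>))"
    using gh_weighted_integrable[OF assms] by simp
  show "AE \<xi> in lborel. norm (norm (\<xi> + c) powr s * gh \<xi>) \<le> norm ((1 + norm c) powr s * ((1 + norm \<xi>) powr s * \<bar>gh \<xi>\<bar>))"
    using mult_right_mono[OF norm_add_powr_le[OF assms]] by (intro AE_I2) (auto simp: abs_mult mult.assoc[symmetric])
qed measurable

section \<open>The fractional Laplacian of a packet on the frequency side\<close>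

lemma fourier_packet:
  "fourier (packet N \<theta>) \<xi> = (\<Sum>m\<in>freqs. of_real (amp m) * cis (m * \<theta>) * of_real (gh (\<xi> - (m * N) *\<^sub>R e)))"
proof -
  have "complex_of_real (packet N \<theta> x) * cis (- (\<xi> \<bullet> x)) =
    (\<Sum>m\<in>freqs. (of_real (amp m) * cis (m * \<theta>)) * (of_real (g x) * cis (- ((\<xi> - (m * N) *\<^sub>R e) \<bullet> x))))" for x
  proof -
    have "cis (m * (N * (x \<bullet> e) + \<theta>)) * cis (- (\<xi> \<bullet> x)) = cis (m * \<theta>) * cis (- ((\<xi> - (m * N) *\<^sub>R e) \<bullet> x))" for m
      by (simp add: cis_mult inner_diff_left inner_commute[of e x] algebra_simps)
    moreover have "a * c1 * G * c2 = (a * c3) * (G * c4)" if "c1 * c2 = c3 * c4" for a c1 c2 c3 c4 G :: complex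
      using that by algebra
    ultimately show ?thesis
      unfolding packet_def of_real_mult profile_sum sum_distrib_right by (intro sum.cong refl) blast
  qed
  then have "fourier (packet N \<theta>) \<xi> = (\<integral>x. (\<Sum>m\<in>freqs. (of_real (amp m) * cis (m * \<theta>)) * (of_real (g x) * cis (- ((\<xi> - (m * N) *\<^sub>R e) \<bullet> x)))) \<partial>lborel)"
    by (simp add: fourier_def)
  also have "\<dots> = (\<Sum>m\<in>freqs. (of_real (amp m) * cis (m * \<theta>)) * (\<integral>x. of_real (g x) * cis (- ((\<xi> - (m * N) *\<^sub>R e) \<bullet> x)) \<partial>lborel))"
    by (subst Bochner_Integration.integral_sum) (auto intro!: integrable_times_cis g_integrable)
  finally show ?thesis by (simp only: fourier_g)
qed

text \<open>The operator conjugated by a modulation: \<open>J s N m\<close> is e^(-i m N x_e) times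
  the fractional Laplacian of e^(i m N x_e) g. The oscillation is removed, which leaves an amplitude
  that can be compared with g.\<close>

definition J :: "real \<Rightarrow> real \<Rightarrow> real \<Rightarrow> 'a \<Rightarrow> complex" where
  "J s N m x = of_real ((1 / (2 * pi)) ^ DIM('a)) *
     (\<integral>\<xi>. of_real (norm (\<xi> + (m * N) *\<^sub>R e) powr s * gh \<xi>) * cis (\<xi> \<bullet> x) \<partial>lborel)"

text \<open>Translating the frequency variable by m N e recentres the shifted copy of
  \<open>gh\<close> at the origin and produces the phase factor
  \<open>cis (m * (N * (x \<bullet> e)))\<close>.\<close>

lemma frac_lap_packet:
  assumes "s > 0"
  shows "frac_lap s (packet N \<theta>) x = Re (\<Sum>m\<in>freqs. of_real (amp m) * cis (m * (N * (x \<bullet> e) + \<theta>)) * J s N m x)"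
proof -
  let ?F = "\<lambda>m \<xi>. of_real (norm \<xi> powr s * gh (\<xi> - (m * N) *\<^sub>R e)) * cis (\<xi> \<bullet> x)"
  have int: "integrable lborel (?F m)" for m
  proof (intro integrable_times_cis)
    show "integrable lborel (\<lambda>\<xi>. norm \<xi> powr s * gh (\<xi> - (m * N) *\<^sub>R e))"
      using lborel_integrable_translate[OF shifted_integrable[OF assms, of "(m * N) *\<^sub>R e"], of "- ((m * N) *\<^sub>R e)"] by simp
  qed measurable
  have F: "(\<integral>\<xi>. ?F m \<xi> \<partial>lborel) = cis (m * (N * (x \<bullet> e))) * (\<integral>\<xi>. of_real (norm (\<xi> + (m * N) *\<^sub>R e) powr s * gh \<xi>) * cis (\<xi> \<bullet> x) \<partial>lborel)" for m
  proof -
    have "(\<integral>\<xi>. ?F m \<xi> \<partial>lborel) = (\<integral>\<xi>. ?F m ((m * N) *\<^sub>R e + \<xi>) \<partial>lborel)"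
      by (rule lborel_integral_translate[symmetric]) (use int in auto)
    also have "\<dots> = (\<integral>\<xi>. cis (m * (N * (x \<bullet> e))) * (of_real (norm (\<xi> + (m * N) *\<^sub>R e) powr s * gh \<xi>) * cis (\<xi> \<bullet> x)) \<partial>lborel)"
      by (intro Bochner_Integration.integral_cong refl)
         (simp add: inner_add_left inner_commute[of e x] cis_mult[symmetric] add.commute mult_ac)
    finally show ?thesis by simp
  qed
  have "(\<integral>\<xi>. complex_of_real (norm \<xi> powr s) * fourier (packet N \<theta>) \<xi> * cis (\<xi> \<bullet> x) \<partial>lborel)
    = (\<integral>\<xi>. (\<Sum>m\<in>freqs. (of_real (amp m) * cis (m * \<theta>)) * ?F m \<xi>) \<partial>lborel)"
    by (intro Bochner_Integration.integral_cong refl)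
       (simp add: fourier_packet sum_distrib_left sum_distrib_right mult_ac)
  also have "\<dots> = (\<Sum>m\<in>freqs. (of_real (amp m) * cis (m * \<theta>)) * (\<integral>\<xi>. ?F m \<xi> \<partial>lborel))"
    by (subst Bochner_Integration.integral_sum) (intro integrable_mult_right int | simp only: integral_mult_right_zero)+
  also have "\<dots> = (\<Sum>m\<in>freqs. of_real (amp m) * cis (m * (N * (x \<bullet> e) + \<theta>)) * (\<integral>\<xi>. of_real (norm (\<xi> + (m * N) *\<^sub>R e) powr s * gh \<xi>) * cis (\<xi> \<bullet> x) \<partial>lborel))"
    unfolding F by (intro sum.cong refl) (simp add: distrib_left cis_mult[symmetric] mult_ac)
  finally show ?thesis
    by (simp add: frac_lap_def J_def sum_distrib_left mult_ac)
qed

lemma J_measurable[measurable]: "J s N m \<in> borel_measurable borel"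
proof -
  have "(\<lambda>x. \<integral>\<xi>. complex_of_real (norm (\<xi> + (m * N) *\<^sub>R e) powr s * gh \<xi>) * cis (\<xi> \<bullet> x) \<partial>lborel) \<in> borel_measurable borel"
  proof (rule lborel.borel_measurable_lebesgue_integral)
    have "(\<lambda>p. cis (snd p \<bullet> fst p)) \<in> borel_measurable (borel \<Otimes>\<^sub>M (lborel :: 'a measure))"
    proof (rule measurable_compose[of "\<lambda>p. snd p \<bullet> fst p" _ borel cis])
      show "cis \<in> borel_measurable borel" by (intro borel_measurable_continuous_onI continuous_intros)
    qed measurable
    then show "(\<lambda>(x, \<xi>). complex_of_real (norm (\<xi> + (m * N) *\<^sub>R e) powr s * gh \<xi>) * cis (\<xi> \<bullet> x)) \<in> borel_measurable (borel \<Otimes>\<^sub>M lborel)"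
      unfolding split_beta by measurable
  qed
  then show ?thesis unfolding J_def[abs_def] by measurable
qed

text \<open>The L^1 distance, weighted by the spectrum of g, between the symbol of \<open>J\<close>
  divided by n^s and its limit |m|^s.\<close>

definition \<delta> :: "real \<Rightarrow> real \<Rightarrow> nat \<Rightarrow> real" where
  "\<delta> s m n = (\<integral>\<xi>. \<bar>norm ((1 / real n) *\<^sub>R \<xi> + m *\<^sub>R e) powr s - \<bar>m\<bar> powr s\<bar> * \<bar>gh \<xi>\<bar> \<partial>lborel)"

text \<open>A majorant that does not depend on n, for dominated convergence. It covers n = 0 as
  well, where \<open>1 / real n\<close> is 0.\<close>

lemma \<delta>_bound:
  assumes "s > 0"
  shows "\<bar>norm ((1 / real n) *\<^sub>R \<xi> + m *\<^sub>R e) powr s - \<bar>m\<bar> powr s\<bar> \<le> 2 * (1 + \<bar>m\<bar>) powr s * (1 + norm \<xi>) powr s"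
proof -
  have ne: "norm (m *\<^sub>R e) = \<bar>m\<bar>" using e by simp
  have "norm ((1 / real n) *\<^sub>R \<xi>) \<le> norm \<xi>"
    using mult_right_mono[of 1 "real n" "norm \<xi>"] by (cases "n = 0") (auto simp: field_simps)
  then have "(1 + norm ((1 / real n) *\<^sub>R \<xi>)) powr s \<le> (1 + norm \<xi>) powr s"
    using assms by (intro powr_mono2) auto
  then have "norm ((1 / real n) *\<^sub>R \<xi> + m *\<^sub>R e) powr s \<le> (1 + \<bar>m\<bar>) powr s * (1 + norm \<xi>) powr s"
    using norm_add_powr_le[OF assms, of "(1 / real n) *\<^sub>R \<xi>" "m *\<^sub>R e"] unfolding ne
    by (meson mult_left_mono order_trans powr_ge_zero)
  moreover have "\<bar>m\<bar> powr s * 1 \<le> (1 + \<bar>m\<bar>) powr s * (1 + norm \<xi>) powr s"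
    using assms by (intro mult_mono powr_mono2 ge_one_powr_ge_zero) auto
  ultimately show ?thesis
    using powr_ge_zero[of "norm ((1 / real n) *\<^sub>R \<xi> + m *\<^sub>R e)" s] powr_ge_zero[of "\<bar>m\<bar>" s]
    unfolding mult.assoc[of 2] mult_1_right abs_le_iff by linarith
qed

lemma \<delta>_tendsto: assumes "s > 0" shows "\<delta> s m \<longlonglongrightarrow> 0"
proof -
  let ?h = "\<lambda>n \<xi>. \<bar>norm ((1 / real n) *\<^sub>R \<xi> + m *\<^sub>R e) powr s - \<bar>m\<bar> powr s\<bar> * \<bar>gh \<xi>\<bar>"
  have "\<delta> s m \<longlonglongrightarrow> integral\<^sup>L (lborel :: 'a measure) (\<lambda>_. 0)" unfolding \<delta>_def[abs_def]
  proof (rule integral_dominated_convergence[of _ _ _ "\<lambda>\<xi>. 2 * (1 + \<bar>m\<bar>) powr s * ((1 + norm \<xi>) powr s * \<bar>gh \<xi>\<bar>)"])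
    show "integrable lborel (\<lambda>\<xi>. 2 * (1 + \<bar>m\<bar>) powr s * ((1 + norm \<xi>) powr s * \<bar>gh \<xi>\<bar>))"
      using gh_weighted_integrable[OF assms] by simp
    show "AE \<xi> in lborel. norm (?h n \<xi>) \<le> 2 * (1 + \<bar>m\<bar>) powr s * ((1 + norm \<xi>) powr s * \<bar>gh \<xi>\<bar>)" for n
      using mult_right_mono[OF \<delta>_bound[OF assms]] by (intro AE_I2) (auto simp: mult.assoc)
    show "AE \<xi> in lborel. (\<lambda>n. ?h n \<xi>) \<longlonglongrightarrow> 0"
    proof (rule AE_I2)
      fix \<xi>
      have "(\<lambda>n. ?h n \<xi>) \<longlonglongrightarrow> \<bar>norm (0 *\<^sub>R \<xi> + m *\<^sub>R e) powr s - \<bar>m\<bar> powr s\<bar> * \<bar>gh \<xi>\<bar>"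
        by (intro tendsto_intros tendsto_powr' lim_1_over_n) (use assms in auto)
      then show "(\<lambda>n. ?h n \<xi>) \<longlonglongrightarrow> 0" using e by simp
    qed
  qed measurable
  then show ?thesis by simp
qed

text \<open>Fourier inversion writes g as a frequency integral of \<open>gh\<close>, so the
  difference is one integral of \<open>gh\<close> against a difference of symbols. Taking absolute
  values makes the bound uniform in x; homogeneity of the norm extracts n^s, and the prefactor (2
  pi)^(-d) is at most 1.\<close>

lemma J_approx:
  assumes "s > 0" "n > 0"
  shows "norm (J s (real n) m x - of_real (\<bar>m\<bar> powr s * real n powr s * g x)) \<le> real n powr s * \<delta> s m n"
proof -
  define c where "c = (1 / (2 * pi)) ^ DIM('a)"
  have c: "0 \<le> c" "c \<le> 1" using pi_gt3 by (auto simp: c_def power_le_one)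
  have c2: "c * (2 * pi) ^ DIM('a) = 1" by (simp add: c_def power_one_over)
  let ?a = "\<lambda>\<xi>. norm (\<xi> + (m * real n) *\<^sub>R e) powr s" and ?k = "\<bar>m\<bar> powr s * real n powr s"
  have i1: "integrable lborel (\<lambda>\<xi>. of_real (?a \<xi> * gh \<xi>) * cis (\<xi> \<bullet> x))"
    by (intro integrable_times_cis shifted_integrable assms) measurable
  have i2: "integrable lborel (\<lambda>\<xi>. of_real (gh \<xi>) * cis (\<xi> \<bullet> x))"
    by (intro integrable_times_cis gh_integrable) measurable
  have ghx: "of_real (g x) = of_real c * (\<integral>\<xi>. complex_of_real (gh \<xi>) * cis (\<xi> \<bullet> x) \<partial>lborel)"
    unfolding inverse_fourier_gh of_real_mult[symmetric] mult.assoc[symmetric] c2 by simp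
  have "J s (real n) m x - of_real (?k * g x) = of_real c *
    ((\<integral>\<xi>. of_real (?a \<xi> * gh \<xi>) * cis (\<xi> \<bullet> x) \<partial>lborel) - (\<integral>\<xi>. of_real ?k * (of_real (gh \<xi>) * cis (\<xi> \<bullet> x)) \<partial>lborel))"
    unfolding of_real_mult[of ?k] ghx J_def c_def[symmetric] integral_mult_right_zero by (simp only: algebra_simps)
  also have "\<dots> = of_real c * (\<integral>\<xi>. of_real (?a \<xi> * gh \<xi>) * cis (\<xi> \<bullet> x) - of_real ?k * (of_real (gh \<xi>) * cis (\<xi> \<bullet> x)) \<partial>lborel)"
    by (subst Bochner_Integration.integral_diff) (use i1 i2 in auto)
  finally have "norm (J s (real n) m x - of_real (?k * g x)) =
     c * norm (\<integral>\<xi>. of_real (?a \<xi> * gh \<xi>) * cis (\<xi> \<bullet> x) - of_real ?k * (of_real (gh \<xi>) * cis (\<xi> \<bullet> x)) \<partial>lborel)"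
    using c by (simp add: norm_mult)
  also have "\<dots> \<le> 1 * (\<integral>\<xi>. norm (of_real (?a \<xi> * gh \<xi>) * cis (\<xi> \<bullet> x) - of_real ?k * (of_real (gh \<xi>) * cis (\<xi> \<bullet> x))) \<partial>lborel)"
    using c by (intro mult_mono integral_norm_bound) auto
  also have "\<dots> = (\<integral>\<xi>. real n powr s * (\<bar>norm ((1 / real n) *\<^sub>R \<xi> + m *\<^sub>R e) powr s - \<bar>m\<bar> powr s\<bar> * \<bar>gh \<xi>\<bar>) \<partial>lborel)"
  proof (subst mult_1, intro Bochner_Integration.integral_cong refl)
    fix \<xi>
    have "\<xi> + (m * real n) *\<^sub>R e = real n *\<^sub>R ((1 / real n) *\<^sub>R \<xi> + m *\<^sub>R e)"
      using assms(2) by (simp add: scaleR_add_right mult.commute)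
    then have a: "?a \<xi> = real n powr s * norm ((1 / real n) *\<^sub>R \<xi> + m *\<^sub>R e) powr s"
      by (simp only: norm_scaleR powr_mult abs_of_nat)
    have "of_real (?a \<xi> * gh \<xi>) * cis (\<xi> \<bullet> x) - of_real ?k * (of_real (gh \<xi>) * cis (\<xi> \<bullet> x)) =
      of_real (real n powr s * ((norm ((1 / real n) *\<^sub>R \<xi> + m *\<^sub>R e) powr s - \<bar>m\<bar> powr s) * gh \<xi>)) * cis (\<xi> \<bullet> x)"
      unfolding a by (simp add: algebra_simps)
    then show "norm (of_real (?a \<xi> * gh \<xi>) * cis (\<xi> \<bullet> x) - of_real ?k * (of_real (gh \<xi>) * cis (\<xi> \<bullet> x))) =
      real n powr s * (\<bar>norm ((1 / real n) *\<^sub>R \<xi> + m *\<^sub>R e) powr s - \<bar>m\<bar> powr s\<bar> * \<bar>gh \<xi>\<bar>)"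
      by (simp add: norm_mult abs_mult del: of_real_mult)
  qed
  also have "\<dots> = real n powr s * \<delta> s m n" by (simp add: \<delta>_def)
  finally show ?thesis .
qed

definition \<epsilon> :: "real \<Rightarrow> nat \<Rightarrow> real" where "\<epsilon> s n = (\<Sum>m\<in>freqs. amp m * \<delta> s m n)"

lemma \<epsilon>_tendsto: "s > 0 \<Longrightarrow> \<epsilon> s \<longlonglongrightarrow> 0"
  unfolding \<epsilon>_def[abs_def] by (rule tendsto_null_sum) (auto intro!: tendsto_mult_right_zero \<delta>_tendsto)

text \<open>The bound is uniform in x and in \<theta>, so the phase can be selected afterwards,
  separately for each n.\<close>

lemma frac_lap_approx:
  assumes "s > 0" "n > 0"
  shows "\<bar>frac_lap s (packet (real n) \<theta>) x - real n powr s * (lap_profile s (real n * (x \<bullet> e) + \<theta>) * g x)\<bar> \<le> real n powr s * \<epsilon> s n"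
proof -
  let ?t = "real n * (x \<bullet> e) + \<theta>"
  let ?D = "\<lambda>m. J s (real n) m x - of_real (\<bar>m\<bar> powr s * real n powr s * g x)"
  have "complex_of_real (real n powr s * (lap_profile s ?t * g x)) = (\<Sum>m\<in>freqs. of_real (amp m) * cis (m * ?t) * of_real (\<bar>m\<bar> powr s * real n powr s * g x))"
    by (simp add: lap_profile_sum sum_distrib_left sum_distrib_right mult_ac)
  then have "real n powr s * (lap_profile s ?t * g x) = Re (\<Sum>m\<in>freqs. of_real (amp m) * cis (m * ?t) * of_real (\<bar>m\<bar> powr s * real n powr s * g x))"
    by (metis Re_complex_of_real)
  then have "frac_lap s (packet (real n) \<theta>) x - real n powr s * (lap_profile s ?t * g x) = Re (\<Sum>m\<in>freqs. of_real (amp m) * cis (m * ?t) * ?D m)"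
    by (simp only: frac_lap_packet[OF assms(1)] minus_complex.sel[symmetric] sum_subtractf[symmetric] right_diff_distrib)
  then have "\<bar>frac_lap s (packet (real n) \<theta>) x - real n powr s * (lap_profile s ?t * g x)\<bar>
      \<le> norm (\<Sum>m\<in>freqs. of_real (amp m) * cis (m * ?t) * ?D m)"
    by (simp only: abs_Re_le_cmod)
  also have "\<dots> \<le> (\<Sum>m\<in>freqs. amp m * (real n powr s * \<delta> s m n))"
  proof (rule sum_norm_le)
    fix m
    have "norm (of_real (amp m) * cis \<tau> * z) = amp m * norm z" for \<tau> z
      by (simp add: norm_mult amp_def)
    then show "norm (of_real (amp m) * cis (m * ?t) * ?D m) \<le> amp m * (real n powr s * \<delta> s m n)"
      by (simp only:) (intro mult_left_mono J_approx assms, simp add: amp_def)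
  qed
  also have "\<dots> = real n powr s * \<epsilon> s n" by (simp add: \<epsilon>_def sum_distrib_left mult_ac)
  finally show ?thesis .
qed

lemma frac_lap_measurable[measurable]: "s > 0 \<Longrightarrow> frac_lap s (packet N \<theta>) \<in> borel_measurable borel"
proof -
  assume "s > 0"
  have [measurable]: "cis \<in> borel_measurable borel" by (intro borel_measurable_continuous_onI continuous_intros)
  show ?thesis
    unfolding frac_lap_packet[OF \<open>s > 0\<close>, abs_def] by measurable
qed

end

section \<open>Two-sided bounds for the pairing and the p-norm\<close>

context wave_packet begin

text \<open>The lower bound on \<open>\<integral>\<bar>f\<bar>\<^sup>p\<close> comes for free from the negativity: the integrand of the
  main term is at most a constant times \<open>\<bar>P\<bar>\<^bsup>p-1\<^esup> \<bar>g\<bar>\<^sup>p\<close>, and \<open>y\<^bsup>p-1\<^esup> \<le> \<eta>\<^bsup>p-1\<^esup> + y\<^sup>p / \<eta>\<close>.\<close>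

lemma packet_estimates:
  assumes s: "s > 2" and p: "1 < p" "p \<le> p_max s"
  shows "\<exists>c>0. \<exists>C. \<exists>N0. \<forall>n\<ge>N0. 0 < n \<and> (\<exists>\<theta>.
    (\<integral>x. frac_lap s (packet (real n) \<theta>) x * pow_sgn p (packet (real n) \<theta> x) \<partial>lborel) \<in> {- C * real n powr s .. - c * real n powr s} \<and>
    (\<integral>x. \<bar>packet (real n) \<theta> x\<bar> powr p \<partial>lborel) \<in> {c..C})"
proof -
  have p2: "p < 2" using p_max_bounds[OF s] p by linarith
  define b where "b = 3 powr (s - 1)"
  have b: "b > 0" by (simp add: b_def)
  obtain \<kappa> where \<kappa>: "\<kappa> > 0" and avg:
    "\<And>y. (\<integral>\<theta>. indicator {0..2*pi} \<theta> * (lap_profile s (y + \<theta>) * pow_sgn p (profile (y + \<theta>))) \<partial>lborel) \<le> - \<kappa>"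
    using profile_average_negative[OF s p] by blast
  define h where "h t = lap_profile s t * pow_sgn p (profile t)" for t
  have P: "\<bar>profile t\<bar> \<le> 4/3" for t by (simp add: profile_def abs_mult power_abs power_le_one)
  have P1: "\<bar>profile t\<bar> powr (p - 1) \<le> 2" for t
  proof -
    have "\<bar>profile t\<bar> powr (p - 1) \<le> (4/3) powr (p - 1)" using P p by (intro powr_mono2) auto
    also have "\<dots> \<le> (4/3) powr 1" using p2 by (intro powr_mono) auto
    finally show ?thesis by simp
  qed
  have Pp: "\<bar>profile t\<bar> powr p \<le> 4" for t
  proof -
    have "\<bar>profile t\<bar> powr p \<le> (4/3) powr p" using P p by (intro powr_mono2) auto
    also have "\<dots> \<le> (4/3) powr 2" using p2 by (intro powr_mono) auto
    finally show ?thesis by (simp add: power2_eq_square)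
  qed
  have lapb: "\<bar>lap_profile s t\<bar> \<le> 1 + b" for t
  proof -
    have "\<bar>lap_profile s t\<bar> \<le> \<bar>cos t\<bar> + b * \<bar>cos (3 * t)\<bar>"
      unfolding lap_profile_def b_def[symmetric] using b by (simp add: abs_mult abs_triangle_ineq[THEN order_trans])
    also have "\<dots> \<le> 1 + b * 1" using b by (intro add_mono mult_left_mono) auto
    finally show ?thesis by simp
  qed
  have hb: "\<bar>h t\<bar> \<le> (1 + b) * \<bar>profile t\<bar> powr (p - 1)" for t
    unfolding h_def abs_mult using p lapb by (simp add: abs_pow_sgn mult_right_mono)
  have hb2: "\<bar>h t\<bar> \<le> (1 + b) * 2" for t
    using hb[of t] mult_left_mono[OF P1[of t], of "1 + b"] b by linarith
  have hc: "continuous_on UNIV h"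
    unfolding h_def lap_profile_def profile_def using p by (intro continuous_intros)
  have [measurable]: "h \<in> borel_measurable borel" "profile \<in> borel_measurable borel"
     "pow_sgn p \<in> borel_measurable borel" "lap_profile s \<in> borel_measurable borel"
    using hc p continuous_on_pow_sgn[OF p(1) continuous_on_id]
    by (auto intro!: borel_measurable_continuous_onI continuous_intros simp: profile_def[abs_def] lap_profile_def[abs_def])
  define W where "W = (\<integral>x. \<bar>g x\<bar> powr p \<partial>lborel)"
  \<comment> \<open>The error in \<open>frac_lap\<close> is uniformly small but need not be
    integrable, so it is the factor |f|^(p-1) that makes the pairing converge; this integral is
    finite because p - 1 > 0 and g decays rapidly.\<close>
  define G where "G = (\<integral>x. \<bar>g x\<bar> powr (p - 1) \<partial>lborel)"
  have W: "W > 0" and G: "G > 0"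
    unfolding W_def G_def using g_powr_integral_pos p by auto
  have Wi: "integrable lborel (\<lambda>x. \<bar>g x\<bar> powr p)" and Gi: "integrable lborel (\<lambda>x. \<bar>g x\<bar> powr (p - 1))"
    using g_powr_integrable p by auto
  \<comment> \<open>Chosen so that (1 + b) \<eta>^(p-1) = \<kappa>/16. This absorbs half of the
    \<kappa>/8 supplied by \<open>exists_shift\<close>; the other half bounds the integral of |f|^p
    from below.\<close>
  define \<eta> where "\<eta> = (\<kappa> / (16 * (1 + b))) powr (1 / (p - 1))"
  have \<eta>: "\<eta> > 0" "\<eta> powr (p - 1) = \<kappa> / (16 * (1 + b))"
    using \<kappa> b p by (auto simp: \<eta>_def powr_powr)
  \<comment> \<open>The first entry is the gap \<kappa>/8 - \<kappa>/16 that survives the error, the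
    second the lower bound for the integral of |f|^p. Likewise C covers the main term plus the
    error, and the bound |P|^p \<le> 4.\<close>
  define c where "c = min (\<kappa> * W / 16) (\<eta> * \<kappa> * W / (16 * (1 + b)))"
  define C where "C = max (2 * (1 + b) * W + \<kappa> * W / 16) (4 * W)"
  have c: "c > 0" using \<kappa> W \<eta> b by (simp add: c_def)
  \<comment> \<open>The error integral is at most n^s times 2 G \<open>\<epsilon> s n\<close>, where
    the 2 bounds |P|^(p-1); below this threshold it costs at most \<kappa> W / 16 times n^s.\<close>
  have "\<forall>\<^sub>F n in sequentially. \<epsilon> s n < \<kappa> * W / (32 * G)"
    using order_tendstoD(2)[OF \<epsilon>_tendsto] s \<kappa> W G by simp
  then obtain N0 where N0: "\<And>n. n \<ge> N0 \<Longrightarrow> \<epsilon> s n < \<kappa> * W / (32 * G)"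
    by (auto simp: eventually_sequentially)
  have "0 < n \<and> (\<exists>\<theta>.
    (\<integral>x. frac_lap s (packet (real n) \<theta>) x * pow_sgn p (packet (real n) \<theta> x) \<partial>lborel) \<in> {- C * real n powr s .. - c * real n powr s} \<and>
    (\<integral>x. \<bar>packet (real n) \<theta> x\<bar> powr p \<partial>lborel) \<in> {c..C})" if n: "n \<ge> Suc N0" for n
  proof
    show "0 < n" using n by simp
    have \<epsilon>: "\<epsilon> s n * (2 * G) \<le> \<kappa> * W / 16" using N0[of n] n G by (simp add: field_simps)
    have ns: "real n powr s > 0" using n by simp
    let ?\<phi> = "\<lambda>x. real n * (x \<bullet> e)"
    obtain \<theta> where \<theta>: "(\<integral>x. h (?\<phi> x + \<theta>) * \<bar>g x\<bar> powr p \<partial>lborel) \<le> - (\<kappa> / 8) * W"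
      using exists_shift[OF hc hb2, of ?\<phi> "\<lambda>x. \<bar>g x\<bar> powr p" \<kappa>] Wi W \<kappa> avg unfolding W_def h_def by auto
    let ?f = "packet (real n) \<theta>" and ?t = "\<lambda>x. ?\<phi> x + \<theta>"
    let ?M = "\<integral>x. h (?t x) * \<bar>g x\<bar> powr p \<partial>lborel"
    let ?R = "\<lambda>x. frac_lap s ?f x - real n powr s * (lap_profile s (?t x) * g x)"
    have f[measurable]: "?f \<in> borel_measurable borel" unfolding packet_def[abs_def] by measurable
    have [measurable]: "frac_lap s ?f \<in> borel_measurable borel" using s by simp
    have Mi: "integrable lborel (\<lambda>x. h (?t x) * \<bar>g x\<bar> powr p)"
    proof (rule Bochner_Integration.integrable_bound)
      show "integrable lborel (\<lambda>x. ((1 + b) * 2) * \<bar>g x\<bar> powr p)" using Wi by simp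
      show "AE x in lborel. norm (h (?t x) * \<bar>g x\<bar> powr p) \<le> norm ((1 + b) * 2 * \<bar>g x\<bar> powr p)"
        using hb2 b by (intro AE_I2) (auto simp: abs_mult intro!: mult_right_mono)
    qed measurable
    have fp1: "\<bar>pow_sgn p (?f x)\<bar> \<le> 2 * \<bar>g x\<bar> powr (p - 1)" for x
      using P1[of "?t x"] p by (simp add: packet_def pow_sgn_mult abs_mult abs_pow_sgn mult_right_mono)
    have Rb: "\<bar>?R x * pow_sgn p (?f x)\<bar> \<le> real n powr s * \<epsilon> s n * (2 * \<bar>g x\<bar> powr (p - 1))" for x
      unfolding abs_mult
      by (intro mult_mono fp1 frac_lap_approx order_trans[OF abs_ge_zero frac_lap_approx]) (use s n in auto)
    have Ri: "integrable lborel (\<lambda>x. ?R x * pow_sgn p (?f x))"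
    proof (rule Bochner_Integration.integrable_bound)
      show "integrable lborel (\<lambda>x. real n powr s * \<epsilon> s n * (2 * \<bar>g x\<bar> powr (p - 1)))" using Gi by simp
      show "AE x in lborel. norm (?R x * pow_sgn p (?f x)) \<le> norm (real n powr s * \<epsilon> s n * (2 * \<bar>g x\<bar> powr (p - 1)))"
        using order_trans[OF Rb abs_ge_self] by (intro AE_I2) (simp only: real_norm_def)
    qed measurable
    have "frac_lap s ?f x * pow_sgn p (?f x) = real n powr s * (h (?t x) * \<bar>g x\<bar> powr p) + ?R x * pow_sgn p (?f x)" for x
    proof -
      have "h (?t x) * \<bar>g x\<bar> powr p = lap_profile s (?t x) * g x * pow_sgn p (?f x)"
        by (simp add: h_def packet_def pow_sgn_mult flip: mult_pow_sgn)
      then show ?thesis by (simp add: algebra_simps)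
    qed
    then have num: "(\<integral>x. frac_lap s ?f x * pow_sgn p (?f x) \<partial>lborel) = real n powr s * ?M + (\<integral>x. ?R x * pow_sgn p (?f x) \<partial>lborel)"
      using Mi Ri by (simp only:) (subst Bochner_Integration.integral_add, auto)
    have "\<bar>\<integral>x. ?R x * pow_sgn p (?f x) \<partial>lborel\<bar> \<le> (\<integral>x. \<bar>?R x * pow_sgn p (?f x)\<bar> \<partial>lborel)"
      by (rule integral_abs_bound)
    also have "\<dots> \<le> (\<integral>x. real n powr s * \<epsilon> s n * (2 * \<bar>g x\<bar> powr (p - 1)) \<partial>lborel)"
      using Gi Ri Rb by (intro integral_mono) auto
    also have "\<dots> = real n powr s * (\<epsilon> s n * (2 * G))" by (simp add: G_def)
    also have "\<dots> \<le> real n powr s * (\<kappa> * W / 16)" using \<epsilon> by (intro mult_left_mono) auto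
    finally have R: "\<bar>\<integral>x. ?R x * pow_sgn p (?f x) \<partial>lborel\<bar> \<le> real n powr s * (\<kappa> * W / 16)" .
    have fp: "\<bar>?f x\<bar> powr p = \<bar>profile (?t x)\<bar> powr p * \<bar>g x\<bar> powr p" for x
      by (simp add: packet_def abs_mult powr_mult)
    have fi: "integrable lborel (\<lambda>x. \<bar>?f x\<bar> powr p)"
    proof (rule Bochner_Integration.integrable_bound)
      show "integrable lborel (\<lambda>x. 4 * \<bar>g x\<bar> powr p)" using Wi by simp
      show "AE x in lborel. norm (\<bar>?f x\<bar> powr p) \<le> norm (4 * \<bar>g x\<bar> powr p)"
        using Pp by (intro AE_I2) (auto simp: fp intro!: mult_right_mono)
    qed measurable
    have "- ?M = (\<integral>x. - (h (?t x) * \<bar>g x\<bar> powr p) \<partial>lborel)" by simp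
    also have "\<dots> \<le> (\<integral>x. (1 + b) * (\<eta> powr (p - 1) * \<bar>g x\<bar> powr p + \<bar>?f x\<bar> powr p / \<eta>) \<partial>lborel)"
    proof (rule integral_mono)
      fix x
      let ?y = "\<bar>profile (?t x)\<bar>"
      have y: "?y powr (p - 1) \<le> \<eta> powr (p - 1) + ?y powr p / \<eta>"
      proof (cases "?y \<le> \<eta>")
        case True
        then have "?y powr (p - 1) \<le> \<eta> powr (p - 1)" using p by (intro powr_mono2) auto
        then show ?thesis using \<eta> by (simp add: add_increasing2)
      next
        case False
        then have "?y powr p = ?y * ?y powr (p - 1)" using \<eta> by (simp add: powr_mult_base)
        moreover have "\<eta> * ?y powr (p - 1) \<le> ?y * ?y powr (p - 1)" using False by (intro mult_right_mono) auto
        ultimately have "?y powr (p - 1) \<le> ?y powr p / \<eta>" using \<eta> by (simp add: field_simps)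
        then show ?thesis using powr_ge_zero[of \<eta> "p - 1"] by linarith
      qed
      have "- (h (?t x) * \<bar>g x\<bar> powr p) \<le> \<bar>h (?t x)\<bar> * \<bar>g x\<bar> powr p"
        using mult_right_mono[of "- h (?t x)" "\<bar>h (?t x)\<bar>" "\<bar>g x\<bar> powr p"] by simp
      also have "\<dots> \<le> (1 + b) * (\<eta> powr (p - 1) + ?y powr p / \<eta>) * \<bar>g x\<bar> powr p"
        using b by (intro mult_right_mono order_trans[OF hb] mult_left_mono y) auto
      finally show "- (h (?t x) * \<bar>g x\<bar> powr p) \<le> (1 + b) * (\<eta> powr (p - 1) * \<bar>g x\<bar> powr p + \<bar>?f x\<bar> powr p / \<eta>)"
        by (simp add: fp algebra_simps)
    qed (use Mi Wi fi in auto)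
    also have "\<dots> = (1 + b) * (\<eta> powr (p - 1) * W + (\<integral>x. \<bar>?f x\<bar> powr p \<partial>lborel) / \<eta>)"
      using Wi fi by (simp add: W_def)
    also have "\<dots> = \<kappa> * W / 16 + (1 + b) * (\<integral>x. \<bar>?f x\<bar> powr p \<partial>lborel) / \<eta>"
      unfolding \<eta>(2) using b by (simp add: field_simps)
    finally have "\<kappa> * W / 16 \<le> (1 + b) * (\<integral>x. \<bar>?f x\<bar> powr p \<partial>lborel) / \<eta>" using \<theta> by argo
    then have low: "\<eta> * \<kappa> * W / (16 * (1 + b)) \<le> (\<integral>x. \<bar>?f x\<bar> powr p \<partial>lborel)"
      using b \<eta> by (simp add: field_simps)
    have "(\<integral>x. \<bar>?f x\<bar> powr p \<partial>lborel) \<le> (\<integral>x. 4 * \<bar>g x\<bar> powr p \<partial>lborel)"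
      using fi Wi Pp by (intro integral_mono) (auto simp: fp intro!: mult_right_mono)
    then have up: "(\<integral>x. \<bar>?f x\<bar> powr p \<partial>lborel) \<le> 4 * W" by (simp add: W_def)
    have "\<bar>?M\<bar> \<le> (\<integral>x. \<bar>h (?t x) * \<bar>g x\<bar> powr p\<bar> \<partial>lborel)" by (rule integral_abs_bound)
    also have "\<dots> \<le> (\<integral>x. (1 + b) * 2 * \<bar>g x\<bar> powr p \<partial>lborel)"
    proof (rule integral_mono)
      show "\<bar>h (?t x) * \<bar>g x\<bar> powr p\<bar> \<le> (1 + b) * 2 * \<bar>g x\<bar> powr p" for x
        unfolding abs_mult using hb2 b by (intro mult_mono) auto
    qed (use integrable_abs[OF Mi] Wi in auto)
    also have "\<dots> = 2 * (1 + b) * W" by (simp add: W_def)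
    finally have "?M \<ge> - (2 * (1 + b) * W)" by linarith
    then have M1: "real n powr s * ?M \<ge> real n powr s * - (2 * (1 + b) * W)" by (intro mult_left_mono) auto
    have M2: "real n powr s * ?M \<le> real n powr s * (- (\<kappa> / 8) * W)" using \<theta> by (intro mult_left_mono) auto
    have C1: "real n powr s * (2 * (1 + b) * W + \<kappa> * W / 16) \<le> real n powr s * C"
      unfolding C_def by (intro mult_left_mono max.cobounded1) auto
    have c1: "real n powr s * c \<le> real n powr s * (\<kappa> * W / 16)"
      unfolding c_def by (intro mult_left_mono min.cobounded1) auto
    have "k * M + r \<in> {- C * k .. - c * k}"
      if "\<bar>r\<bar> \<le> k * (\<kappa> * W / 16)" "k * M \<ge> k * - B" "k * M \<le> k * (- (\<kappa> / 8) * W)"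
        "k * (B + \<kappa> * W / 16) \<le> k * C" "k * c \<le> k * (\<kappa> * W / 16)" for k M r B
      using that(1)[unfolded abs_le_iff] that(2-) by (simp add: algebra_simps)
    from this[OF R M1 M2 C1 c1]
    have "(\<integral>x. frac_lap s ?f x * pow_sgn p (?f x) \<partial>lborel) \<in> {- C * real n powr s .. - c * real n powr s}"
      unfolding num .
    moreover have "(\<integral>x. \<bar>?f x\<bar> powr p \<partial>lborel) \<in> {c..C}" using low up by (auto simp: c_def C_def)
    ultimately show "\<exists>\<theta>.
    (\<integral>x. frac_lap s (packet (real n) \<theta>) x * pow_sgn p (packet (real n) \<theta> x) \<partial>lborel) \<in> {- C * real n powr s .. - c * real n powr s} \<and>
    (\<integral>x. \<bar>packet (real n) \<theta> x\<bar> powr p \<partial>lborel) \<in> {c..C}" by blast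
  qed
  then show ?thesis using c by blast
qed

text \<open>The modulation involves a single coordinate, so the packet is itself a tensor product
  and inherits smoothness and decay from its factors.\<close>

lemma packet_tensor: "packet N \<theta> = tensor (\<lambda>b. if b = e then (\<lambda>t. profile (N * t + \<theta>) * u t) else u)"
proof
  fix x
  have "tensor (\<lambda>b. if b = e then (\<lambda>t. profile (N * t + \<theta>) * u t) else u) x =
     (profile (N * (x \<bullet> e) + \<theta>) * u (x \<bullet> e)) * (\<Prod>b\<in>Basis - {e}. u (x \<bullet> b))"
    unfolding tensor_def by (subst prod.remove[OF _ e]) (auto intro!: prod.cong)
  also have "\<dots> = packet N \<theta> x"
    unfolding packet_def g_def tensor_def by (subst prod.remove[OF _ e]) auto
  finally show "packet N \<theta> x = tensor (\<lambda>b. if b = e then (\<lambda>t. profile (N * t + \<theta>) * u t) else u) x" ..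
qed

lemma all_derivs_profile_times: "all_derivs rapid (\<lambda>t. profile (N * t + \<theta>) * u t)"
proof -
  have "(\<lambda>t. 1 * cos (N * t + \<theta>) * u t + 1/3 * cos ((3 * N) * t + 3 * \<theta>) * u t) \<in> modulated"
    by (intro modulated.intros u)
  moreover have "(\<lambda>t. 1 * cos (N * t + \<theta>) * u t + 1/3 * cos ((3 * N) * t + 3 * \<theta>) * u t) = (\<lambda>t. profile (N * t + \<theta>) * u t)"
  proof
    fix t
    have "(3 * N) * t + 3 * \<theta> = 3 * (N * t + \<theta>)" by simp
    then show "1 * cos (N * t + \<theta>) * u t + 1/3 * cos ((3 * N) * t + 3 * \<theta>) * u t = profile (N * t + \<theta>) * u t"
      by (simp only: cos_triple profile_def) (simp add: algebra_simps)
  qed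
  ultimately show ?thesis using all_derivs_modulated by metis
qed

lemma schwartz_packet: "schwartz (packet N \<theta>)"
  unfolding packet_tensor using u all_derivs_profile_times by (intro schwartz_tensor) auto

lemma tensor_supp1:
  fixes x :: 'a
  assumes "supp1 w" "tensor (\<lambda>_. w) x \<noteq> 0" shows "norm x \<le> real DIM('a)"
proof -
  have "\<bar>x \<bullet> b\<bar> \<le> 1" if "b \<in> Basis" for b
  proof (rule ccontr)
    assume "\<not> ?thesis"
    then have "w (x \<bullet> b) = 0" using assms(1) by (auto simp: supp1_def)
    then show False using assms(2) that by (auto simp: tensor_def)
  qed
  then have "(\<Sum>b\<in>Basis. \<bar>x \<bullet> b\<bar>) \<le> (\<Sum>b\<in>(Basis::'a set). 1)" by (intro sum_mono) auto
  then show ?thesis using norm_le_l1[of x] by simp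
qed

lemma smooth_compact_support_packet:
  assumes "supp1 u" shows "smooth_compact_support (packet N \<theta>)"
  unfolding smooth_compact_support_def
proof
  show "smooth (packet N \<theta>)" using schwartz_packet by (simp add: schwartz_def)
  have "{x. packet N \<theta> x \<noteq> 0} \<subseteq> cball 0 (real DIM('a))"
    using tensor_supp1[OF assms] by (auto simp: packet_def g_def)
  then show "compact (closure {x. packet N \<theta> x \<noteq> 0})"
    by (metis bounded_cball bounded_subset compact_closure)
qed

text \<open>The spectrum lies in balls of radius d about m N e with |m| equal to 1 or 3. Since d <
  N/2, these avoid |\<xi>| \<le> N/2 and stay inside |\<xi>| < 4N. The union of balls is closed,
  which takes care of the closure.\<close>

lemma fourier_support_packet:
  assumes "supp1 v" and N: "N > 2 * real DIM('a)"
  shows "closure {\<xi>. fourier (packet N \<theta>) \<xi> \<noteq> 0} \<subseteq> {\<xi>. 1/2 * N < norm \<xi> \<and> norm \<xi> < 4 * N}"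
proof -
  have "{\<xi>. fourier (packet N \<theta>) \<xi> \<noteq> 0} \<subseteq> (\<Union>m\<in>freqs. cball ((m * N) *\<^sub>R e) (real DIM('a)))"
  proof
    fix \<xi> assume "\<xi> \<in> {\<xi>. fourier (packet N \<theta>) \<xi> \<noteq> 0}"
    then obtain m where "m \<in> freqs" "gh (\<xi> - (m * N) *\<^sub>R e) \<noteq> 0"
      unfolding fourier_packet mem_Collect_eq by (metis (mono_tags, lifting) mult_zero_right of_real_0 sum.neutral)
    then show "\<xi> \<in> (\<Union>m\<in>freqs. cball ((m * N) *\<^sub>R e) (real DIM('a)))"
      using tensor_supp1[OF assms(1)] by (auto simp: gh_def dist_norm norm_minus_commute)
  qed
  then have "closure {\<xi>. fourier (packet N \<theta>) \<xi> \<noteq> 0} \<subseteq> (\<Union>m\<in>freqs. cball ((m * N) *\<^sub>R e) (real DIM('a)))"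
    by (intro closure_minimal closed_UN) auto
  also have "\<dots> \<subseteq> {\<xi>. 1/2 * N < norm \<xi> \<and> norm \<xi> < 4 * N}"
  proof
    fix \<xi> assume "\<xi> \<in> (\<Union>m\<in>freqs. cball ((m * N) *\<^sub>R e) (real DIM('a)))"
    then obtain m where m: "m \<in> freqs" "norm ((m * N) *\<^sub>R e - \<xi>) \<le> real DIM('a)" by (auto simp: dist_norm)
    have ne: "norm ((m * N) *\<^sub>R e) = \<bar>m\<bar> * N" using e N by (simp add: abs_mult)
    have "1 \<le> \<bar>m\<bar>" "\<bar>m\<bar> \<le> 3" using m(1) by (auto simp: freqs_def)
    then have mN: "1 * N \<le> \<bar>m\<bar> * N" "\<bar>m\<bar> * N \<le> 3 * N" using N by (auto intro!: mult_right_mono)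
    have "\<bar>m\<bar> * N - norm \<xi> \<le> real DIM('a)" "norm \<xi> - \<bar>m\<bar> * N \<le> real DIM('a)"
      using m(2) norm_triangle_ineq2[of "(m * N) *\<^sub>R e" \<xi>] norm_triangle_ineq2[of \<xi> "(m * N) *\<^sub>R e"]
      unfolding ne norm_minus_commute[of \<xi>] by linarith+
    then show "\<xi> \<in> {\<xi>. 1/2 * N < norm \<xi> \<and> norm \<xi> < 4 * N}"
      using mN N unfolding mem_Collect_eq by linarith
  qed
  finally show ?thesis .
qed

end

section \<open>The bump and its transform as profiles\<close>

lemma integral_even_cis:
  assumes w: "integrable lborel w" and even: "\<And>t. w (- t) = w t"
  shows "(\<integral>t. complex_of_real (w t) * cis (\<tau> * t) \<partial>lborel) = of_real (\<integral>t. w t * cos (\<tau> * t) \<partial>lborel)"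
proof -
  have i: "integrable lborel (\<lambda>t. complex_of_real (w t) * cis (\<tau> * t))"
    by (rule integrable_times_cis[OF w]) measurable
  have "(\<integral>t. w t * sin (\<tau> * t) \<partial>lborel) = - (\<integral>t. w t * sin (\<tau> * t) \<partial>lborel)"
    using lborel_integral_real_affine[of "- 1" "\<lambda>t. w t * sin (\<tau> * t)" 0] by (simp add: even)
  then have "(\<integral>t. w t * sin (\<tau> * t) \<partial>lborel) = 0" by simp
  then show ?thesis
    using integral_Re[OF i] integral_Im[OF i] by (simp add: complex_eq_iff)
qed

lemma cos_transform_even: "cos_transform w 0 (- t) = cos_transform w 0 t"
  by (simp add: cos_transform_def)

lemma bump_integrable: "integrable lborel bump"
  by (rule rapid_integrable1[OF all_derivs_supp1_rapid[OF all_derivs_bump]])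

lemma cos_transform_bump_integrable: "integrable lborel (cos_transform bump 0)"
  by (rule rapid_integrable1[OF all_derivs_cos_transform[OF all_derivs_bump]])

lemma fourier_bump: "(\<integral>t. complex_of_real (bump t) * cis (\<tau> * t) \<partial>lborel) = of_real (cos_transform bump 0 \<tau>)"
  by (subst integral_even_cis[OF bump_integrable bump_even]) (simp add: cos_transform_def)

lemma fourier_cos_transform_bump: "(\<integral>t. complex_of_real (cos_transform bump 0 t) * cis (\<tau> * t) \<partial>lborel) = of_real (2 * pi * bump \<tau>)"
  by (subst integral_even_cis[OF cos_transform_bump_integrable cos_transform_even])
     (simp only: mult.commute[of \<tau>] cos_inversion[OF all_derivs_bump bump_even])

lemma wave_packet_bump: "e \<in> Basis \<Longrightarrow> wave_packet bump (cos_transform bump 0) e"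
proof
  show "(\<integral>t. complex_of_real (bump t) * cis (- (\<tau> * t)) \<partial>lborel) = of_real (cos_transform bump 0 \<tau>)" for \<tau>
    using fourier_bump[of "- \<tau>"] by (simp add: cos_transform_even)
  show "(\<integral>\<tau>. complex_of_real (cos_transform bump 0 \<tau>) * cis (\<tau> * t) \<partial>lborel) = of_real (2 * pi * bump t)" for t
    using fourier_cos_transform_bump[of t] by (simp only: mult.commute[of _ t])
qed (use bump_pos[of 0] in \<open>auto intro: all_derivs_bump all_derivs_supp1_rapid all_derivs_cos_transform\<close>)

lemma all_derivs_supp1_2pi_bump: "all_derivs supp1 (\<lambda>t. 2 * pi * bump t)"
  using all_derivs_lincomb[OF _ all_derivs_bump all_derivs_bump, of "2 * pi" 0] by (simp add: supp1_def)

text \<open>The roles of the two functions are exchanged, so that now the spectrum is compact; the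
  factor 2 pi is that of the unnormalised inversion formula.\<close>

lemma wave_packet_cos_transform_bump: "e \<in> Basis \<Longrightarrow> wave_packet (cos_transform bump 0) (\<lambda>t. 2 * pi * bump t) e"
proof
  show "(\<integral>t. complex_of_real (cos_transform bump 0 t) * cis (- (\<tau> * t)) \<partial>lborel) = of_real (2 * pi * bump \<tau>)" for \<tau>
    using fourier_cos_transform_bump[of "- \<tau>"] by (simp add: bump_even)
  show "(\<integral>\<tau>. complex_of_real (2 * pi * bump \<tau>) * cis (\<tau> * t) \<partial>lborel) = of_real (2 * pi * cos_transform bump 0 t)" for t
    using fourier_bump[of t] by (simp add: mult.assoc mult.commute[of _ t])
  show "cos_transform bump 0 0 \<noteq> 0"
  proof -
    \<comment> \<open>The transform at 0 is the integral of the bump; its positivity is read off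
      from the first instance in dimension one, with exponent 1.\<close>
    have "0 < (\<integral>t. \<bar>bump t\<bar> powr 1 \<partial>lborel)"
      using wave_packet.g_powr_integral_pos[OF wave_packet_bump[of "1 :: real"], of 1]
      by (simp add: wave_packet.g_def[OF wave_packet_bump[of "1 :: real"]] tensor_def)
    then have "0 < (\<integral>t. bump t \<partial>lborel)" using bump_nonneg by simp
    then show ?thesis by (simp add: cos_transform_def)
  qed
qed (auto intro: all_derivs_supp1_2pi_bump all_derivs_supp1_rapid all_derivs_cos_transform all_derivs_bump)

theorem theorem3p5:
  fixes s :: real
  assumes "s > 2"
  shows "\<exists>p1. 1 < p1 \<and> p1 < 2 \<and>
    (\<forall>p. 1 < p \<and> p \<le> p1 \<longrightarrow>
      (\<exists>C > 0. \<exists>f :: 'a::euclidean_space \<Rightarrow> real. smooth_compact_support f \<and>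
          (\<integral>x. frac_lap s f x * pow_sgn p (f x) \<partial>lborel) \<le> - C)
    \<and> (\<exists>D1 D2 \<alpha>1 \<alpha>2. D1 > 0 \<and> D2 > 0 \<and> \<alpha>1 > 0 \<and> \<alpha>2 > 0 \<and>
        (\<exists>(N :: nat \<Rightarrow> real) (f :: nat \<Rightarrow> 'a \<Rightarrow> real). filterlim N at_top sequentially \<and>
          (\<forall>j. schwartz (f j) \<and>
               closure {\<xi>. fourier (f j) \<xi> \<noteq> 0} \<subseteq> {\<xi>. \<alpha>1 * N j < norm \<xi> \<and> norm \<xi> < \<alpha>2 * N j} \<and>
               - D2 < (\<integral>x. frac_lap s (f j) x * pow_sgn p (f j x) \<partial>lborel) /
                        (N j powr s * (\<integral>x. \<bar>f j x\<bar> powr p \<partial>lborel)) \<and>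
               (\<integral>x. frac_lap s (f j) x * pow_sgn p (f j x) \<partial>lborel) /
                        (N j powr s * (\<integral>x. \<bar>f j x\<bar> powr p \<partial>lborel)) < - D1))))"
proof (rule exI[of _ "p_max s"], intro conjI allI impI)
  show "1 < p_max s" "p_max s < 2" using p_max_bounds[OF assms] by auto
  fix p :: real assume "1 < p \<and> p \<le> p_max s"
  then have p: "1 < p" "p \<le> p_max s" by auto
  obtain e :: 'a where e: "e \<in> Basis" using nonempty_Basis by blast
  show "\<exists>C > 0. \<exists>f :: 'a \<Rightarrow> real. smooth_compact_support f \<and> (\<integral>x. frac_lap s f x * pow_sgn p (f x) \<partial>lborel) \<le> - C"
  proof -
    interpret wave_packet bump "cos_transform bump 0" e by (rule wave_packet_bump[OF e])
    obtain c C N0 where c: "c > 0" and est: "\<forall>n\<ge>N0. 0 < n \<and> (\<exists>\<theta>.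
      (\<integral>x. frac_lap s (packet (real n) \<theta>) x * pow_sgn p (packet (real n) \<theta> x) \<partial>lborel) \<in> {- C * real n powr s .. - c * real n powr s} \<and>
      (\<integral>x. \<bar>packet (real n) \<theta> x\<bar> powr p \<partial>lborel) \<in> {c..C})"
      using packet_estimates[OF assms p] by blast
    \<comment> \<open>Part (i) asks for one function, so the estimate is evaluated at
      \<open>N0\<close> only; the constant is then \<open>c * real N0 powr s\<close>.\<close>
    from est obtain \<theta> where "0 < N0" "(\<integral>x. frac_lap s (packet (real N0) \<theta>) x * pow_sgn p (packet (real N0) \<theta> x) \<partial>lborel) \<le> - (c * real N0 powr s)"
      by (metis atLeastAtMost_iff le_refl mult_minus_left)
    then show ?thesis
      using c smooth_compact_support_packet[OF all_derivsD[OF all_derivs_bump]]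
      by (intro exI[of _ "c * real N0 powr s"] conjI exI[of _ "packet (real N0) \<theta>"]) auto
  qed
  show "\<exists>D1 D2 \<alpha>1 \<alpha>2. D1 > 0 \<and> D2 > 0 \<and> \<alpha>1 > 0 \<and> \<alpha>2 > 0 \<and>
        (\<exists>(N :: nat \<Rightarrow> real) (f :: nat \<Rightarrow> 'a \<Rightarrow> real). filterlim N at_top sequentially \<and>
          (\<forall>j. schwartz (f j) \<and>
               closure {\<xi>. fourier (f j) \<xi> \<noteq> 0} \<subseteq> {\<xi>. \<alpha>1 * N j < norm \<xi> \<and> norm \<xi> < \<alpha>2 * N j} \<and>
               - D2 < (\<integral>x. frac_lap s (f j) x * pow_sgn p (f j x) \<partial>lborel) /
                        (N j powr s * (\<integral>x. \<bar>f j x\<bar> powr p \<partial>lborel)) \<and>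
               (\<integral>x. frac_lap s (f j) x * pow_sgn p (f j x) \<partial>lborel) /
                        (N j powr s * (\<integral>x. \<bar>f j x\<bar> powr p \<partial>lborel)) < - D1))"
  proof -
    interpret wave_packet "cos_transform bump 0" "\<lambda>t. 2 * pi * bump t" e by (rule wave_packet_cos_transform_bump[OF e])
    obtain c C N0 where c: "c > 0" and est: "\<forall>n\<ge>N0. 0 < n \<and> (\<exists>\<theta>.
      (\<integral>x. frac_lap s (packet (real n) \<theta>) x * pow_sgn p (packet (real n) \<theta> x) \<partial>lborel) \<in> {- C * real n powr s .. - c * real n powr s} \<and>
      (\<integral>x. \<bar>packet (real n) \<theta> x\<bar> powr p \<partial>lborel) \<in> {c..C})"
      using packet_estimates[OF assms p] by blast
    \<comment> \<open>The maximum places every frequency in the range of the estimates and above 2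
      d, as the support lemma requires; adding j makes the sequence diverge.\<close>
    define N where "N j = j + max N0 (2 * DIM('a) + 1)" for j :: nat
    let ?num = "\<lambda>f :: 'a \<Rightarrow> real. \<integral>x. frac_lap s f x * pow_sgn p (f x) \<partial>lborel" and ?den = "\<lambda>f :: 'a \<Rightarrow> real. \<integral>x. \<bar>f x\<bar> powr p \<partial>lborel"
    have "\<forall>j. \<exists>\<theta>. ?num (packet (real (N j)) \<theta>) \<in> {- C * real (N j) powr s .. - c * real (N j) powr s} \<and> ?den (packet (real (N j)) \<theta>) \<in> {c..C}"
    proof
      fix j
      have "N0 \<le> N j" by (simp add: N_def)
      then show "\<exists>\<theta>. ?num (packet (real (N j)) \<theta>) \<in> {- C * real (N j) powr s .. - c * real (N j) powr s} \<and> ?den (packet (real (N j)) \<theta>) \<in> {c..C}"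
        using est by blast
    qed
    from choice[OF this] obtain \<theta> where \<theta>: "\<And>j. ?num (packet (real (N j)) (\<theta> j)) \<in> {- C * real (N j) powr s .. - c * real (N j) powr s}"
      "\<And>j. ?den (packet (real (N j)) (\<theta> j)) \<in> {c..C}" by blast
    have C: "C > 0" using \<theta>(2)[of 0] c by auto
    \<comment> \<open>The bounds on numerator and denominator confine the quotient to [-C/c, -c/C];
      the factors 2 turn these into the strict inequalities required.\<close>
    have ratio: "- (2 * C / c) < y / (k * d) \<and> y / (k * d) < - (c / (2 * C))"
      if "k > 0" "y \<in> {- C * k .. - c * k}" "d \<in> {c..C}" for k y d :: real
    proof
      have d: "d > 0" using that c by auto
      have "C * k * c \<le> C * k * d" using that c C by (intro mult_left_mono) auto
      moreover have "c * k * d \<le> c * k * C" using that c C by (intro mult_left_mono) auto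
      moreover have "C * k * d > 0" "c * k * C > 0" using d C c that by auto
      moreover have "- C * k * c \<le> y * c" "y * C \<le> - c * k * C"
        using that mult_right_mono[of "- C * k" y c] mult_right_mono[of y "- c * k" C] c C by auto
      ultimately have "- (2 * C) * (k * d) < y * c" "y * (2 * C) < - c * (k * d)" by (simp_all add: algebra_simps)
      then show "- (2 * C / c) < y / (k * d)" "y / (k * d) < - (c / (2 * C))"
        using c C d that by (simp_all add: divide_simps mult_ac)
    qed
    have "filterlim (\<lambda>j. real (N j)) at_top sequentially"
      unfolding N_def by (intro filterlim_compose[OF filterlim_real_sequentially] filterlim_add_const_nat_at_top)
    moreover have "schwartz (packet (real (N j)) (\<theta> j))" for j by (rule schwartz_packet)
    moreover have "closure {\<xi>. fourier (packet (real (N j)) (\<theta> j)) \<xi> \<noteq> 0} \<subseteq> {\<xi>. 1/2 * real (N j) < norm \<xi> \<and> norm \<xi> < 4 * real (N j)}" for j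
      by (rule fourier_support_packet[OF all_derivsD[OF all_derivs_supp1_2pi_bump]]) (simp add: N_def)
    moreover have "real (N j) powr s > 0" for j by (simp add: N_def)
    ultimately show ?thesis
      using c C ratio[OF _ \<theta>]
      by (rule_tac exI[of _ "c / (2 * C)"], rule_tac exI[of _ "2 * C / c"], rule_tac exI[of _ "1/2"], rule_tac exI[of _ 4],
          intro conjI exI[of _ "\<lambda>j. real (N j)"] exI[of _ "\<lambda>j. packet (real (N j)) (\<theta> j)"] allI) auto
  qed
qed

end
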